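(* Let $(X_n)_{n\ge 1}$ be the unbalanced step-reinforced random walk with parameters $p\in[0,1]$ and $\alpha\in(0,1]$ built from the i.i.d. real random variables $(\xi_n)_{n\ge1}$, let $T_n=\sum_{k=1}^n X_k$ and $a=(2p-1)\alpha$. If $-1\le a<1$ and $\mathbb E[|\xi_1|]<+\infty$, then, with $\mu_1=\mathbb E[\xi_1]$, $$\frac{T_n}{n}\longrightarrow \frac{(1-\alpha)\mu_1}{1-a}\quad\text{almost surely as } n\to+\infty.$$
   Context: Unbalanced step-reinforced random walk with parameters $(p,\alpha)$: let $(\xi_n)_{n\ge1}$ be i.i.d. real random variables, let $(U_n)_{n\ge1}$ be independent with $U_n$ uniform on $\{1,\dots,n\}$, let $(\gamma_n)_{n\ge1}$ be i.i.d. with $\mathbb P(\gamma_n=1)=\alpha=1-\mathbb P(\gamma_n=0)$, and let $(\rho_n)_{n\ge1}$ be i.i.d. with $\mathbb P(\rho_n=1)=p=1-\mathbb P(\rho_n=-1)$; the four sequences are mutually independent. The steps are $X_1=\xi_1$ and, for $n\ge1$, $X_{n+1}=\gamma_n\rho_nX_{U_n}+(1-\gamma_n)\xi_{n+1}$; that is, $X_{n+1}$ equals $X_{U_n}$ with probability $p\alpha$, $-X_{U_n}$ with probability $(1-p)\alpha$, and $\xi_{n+1}$ with probability $1-\alpha$. *)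

theory Defs
  imports "HOL-Probability.Probability"
begin

datatype source = Innovation | Uniform_Index | Memory | Sign

text \<open>
  All sequences are indexed from 1; values at index 0 are irrelevant. The variables \<open>U n\<close> lie in
  \<open>{1..n}\<close> only almost surely, so the recursion for the steps is an almost sure identity.
  In \<open>indep_sources\<close> each sequence is one random element of a countable product space;
  \<open>U\<close> is embedded into the reals so that the four sequences share a type.
\<close>

locale unbalanced_srrw = prob_space M
  for M :: "'a measure"
    and \<xi> :: "nat \<Rightarrow> 'a \<Rightarrow> real"
    and U :: "nat \<Rightarrow> 'a \<Rightarrow> nat"
    and \<gamma> :: "nat \<Rightarrow> 'a \<Rightarrow> real"
    and \<rho> :: "nat \<Rightarrow> 'a \<Rightarrow> real"
    and X :: "nat \<Rightarrow> 'a \<Rightarrow> real"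
    and p :: real
    and \<alpha> :: real +
  assumes indep_\<xi>: "indep_vars (\<lambda>_. borel) \<xi> {1..}"
    and ident_\<xi>: "\<And>n. n \<ge> 1 \<Longrightarrow> distr M borel (\<xi> n) = distr M borel (\<xi> 1)"
    and indep_U: "indep_vars (\<lambda>_. count_space UNIV) U {1..}"
    and unif_U: "\<And>n. n \<ge> 1 \<Longrightarrow> distr M (count_space UNIV) (U n) = measure_pmf (pmf_of_set {1..n})"
    and indep_\<gamma>: "indep_vars (\<lambda>_. borel) \<gamma> {1..}"
    and prob_\<gamma>_1: "\<And>n. n \<ge> 1 \<Longrightarrow> prob {\<omega> \<in> space M. \<gamma> n \<omega> = 1} = \<alpha>"
    and prob_\<gamma>_0: "\<And>n. n \<ge> 1 \<Longrightarrow> prob {\<omega> \<in> space M. \<gamma> n \<omega> = 0} = 1 - \<alpha>"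
    and indep_\<rho>: "indep_vars (\<lambda>_. borel) \<rho> {1..}"
    and prob_\<rho>_1: "\<And>n. n \<ge> 1 \<Longrightarrow> prob {\<omega> \<in> space M. \<rho> n \<omega> = 1} = p"
    and prob_\<rho>_minus_1: "\<And>n. n \<ge> 1 \<Longrightarrow> prob {\<omega> \<in> space M. \<rho> n \<omega> = - 1} = 1 - p"
    and indep_sources:
      "indep_vars (\<lambda>_. PiM {1..} (\<lambda>_. borel))
         (\<lambda>s \<omega>. \<lambda>n\<in>{1..}. case s of
             Innovation \<Rightarrow> \<xi> n \<omega>
           | Uniform_Index \<Rightarrow> real (U n \<omega>)
           | Memory \<Rightarrow> \<gamma> n \<omega>
           | Sign \<Rightarrow> \<rho> n \<omega>)
         (UNIV :: source set)"
    and measurable_X: "\<And>n. n \<ge> 1 \<Longrightarrow> random_variable borel (X n)"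
    and X_1: "AE \<omega> in M. X 1 \<omega> = \<xi> 1 \<omega>"
    and X_Suc: "\<And>n. n \<ge> 1 \<Longrightarrow> AE \<omega> in M.
      X (n + 1) \<omega> = \<gamma> n \<omega> * \<rho> n \<omega> * X (U n \<omega>) \<omega> + (1 - \<gamma> n \<omega>) * \<xi> (n + 1) \<omega>"

definition walk :: "(nat \<Rightarrow> 'a \<Rightarrow> real) \<Rightarrow> nat \<Rightarrow> 'a \<Rightarrow> real" where
  "walk X n \<omega> = (\<Sum>k=1..n. X k \<omega>)"

end

theory Submission
  imports Defs
begin

text \<open>
  Truncate \<open>\<xi>\<^sub>n\<close> at \<open>max n K\<close> and let \<open>Y\<close> be the steps built from the truncated innovations, with
  partial sums \<open>S\<close>. By Borel-Cantelli, almost surely \<open>X = Y\<close> for some \<open>K\<close>. The variables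
  \<open>Y\<^sub>n\<^sub>+\<^sub>1 - a S\<^sub>n / n - (1 - \<alpha>) m\<^sub>n\<^sub>+\<^sub>1\<close>, where \<open>m\<^sub>n\<close> is the mean of the truncated \<open>\<xi>\<^sub>n\<close>, are martingale
  differences. Since a step has the absolute value of an earlier truncated innovation, the second
  moment of \<open>Y\<^sub>n\<close> is at most that of the truncated \<open>\<xi>\<^sub>n\<close>, as in Kolmogorov's strong law; hence the
  martingale with these differences divided by \<open>n + 1\<close> converges almost surely. On each such path
  \<open>A\<^sub>n = S\<^sub>n / n\<close> satisfies \<open>A\<^sub>n\<^sub>+\<^sub>1 = A\<^sub>n (1 - (1 - a) / (n + 1)) + (1 - \<alpha>) m\<^sub>n\<^sub>+\<^sub>1 / (n + 1) + d\<^sub>n\<close> with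
  summable \<open>d\<close>, which forces the limit because \<open>1 - a > 0\<close>.
\<close>

subsection \<open>Deterministic estimates\<close>

text \<open>Once \<open>Suc n \<ge> c\<close>, the factors \<open>1 - c / Suc n\<close> are
  nonnegative, and errors below \<open>\<epsilon> * c\<close> make the excess of
  \<open>\<bar>E n\<bar>\<close> over \<open>\<epsilon>\<close> shrink by such a factor at each
  step. The product of the factors is at most the exponential of \<open>- c\<close> times an
  increment of the harmonic numbers \<open>h\<close>, which diverge.\<close>

lemma contraction_step_tendsto_0:
  fixes E e :: "nat \<Rightarrow> real" and c :: real
  assumes c: "c > 0"
    and rec: "\<And>n. n \<ge> 1 \<Longrightarrow> E (Suc n) = E n * (1 - c / Suc n) + e (Suc n) / Suc n"
    and e: "e \<longlonglongrightarrow> 0"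
  shows "E \<longlonglongrightarrow> 0"
proof (rule LIMSEQ_I)
  fix r :: real assume r: "r > 0"
  define \<epsilon> where "\<epsilon> = r / 2"
  have \<epsilon>: "\<epsilon> > 0" using r by (simp add: \<epsilon>_def)
  obtain N0 where N0: "\<And>n. n \<ge> N0 \<Longrightarrow> \<bar>e n\<bar> < \<epsilon> * c"
    using LIMSEQ_D[OF e, of "\<epsilon> * c"] \<epsilon> c by auto
  define N where "N = max (max N0 (nat \<lceil>c\<rceil>)) 1"
  have N: "N \<ge> N0" "real N \<ge> c" "N \<ge> 1"
    unfolding N_def by linarith+
  have shrink: "\<bar>E (Suc n)\<bar> - \<epsilon> \<le> (1 - c / Suc n) * (\<bar>E n\<bar> - \<epsilon>)" if "n \<ge> N" for n
  proof -
    have f: "0 \<le> 1 - c / Suc n"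
      using that N c by (simp add: field_simps)
    have "\<bar>E (Suc n)\<bar> \<le> \<bar>E n * (1 - c / Suc n)\<bar> + \<bar>e (Suc n) / Suc n\<bar>"
      unfolding rec[OF order_trans[OF N(3) that]] by (rule abs_triangle_ineq)
    also have "\<bar>E n * (1 - c / Suc n)\<bar> = (1 - c / Suc n) * \<bar>E n\<bar>"
      using f by (simp add: abs_mult)
    also have "\<bar>e (Suc n) / Suc n\<bar> = \<bar>e (Suc n)\<bar> / Suc n"
      by (simp add: abs_divide)
    also have "\<dots> \<le> \<epsilon> * c / Suc n"
      using N0[of "Suc n"] that N by (intro divide_right_mono) auto
    finally have "\<bar>E (Suc n)\<bar> \<le> (1 - c / Suc n) * \<bar>E n\<bar> + \<epsilon> * (c / Suc n)" by simp
    moreover have "x \<le> (1 - q) * y + z * q \<Longrightarrow> x - z \<le> (1 - q) * (y - z)" for x y z q :: real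
      by (simp add: algebra_simps)
    ultimately show ?thesis by blast
  qed
  define h where "h n = (\<Sum>k=1..n. 1 / real k)" for n
  have h_Suc: "h (Suc n) = h n + 1 / Suc n" for n by (simp add: h_def)
  \<comment> \<open>The right side starts from \<open>\<bar>E N\<bar>\<close>, not from the excess
    at \<open>N\<close>. It is thus nonnegative, so the factor may be enlarged to an exponential
    even where the excess on the left is negative.\<close>
  have bound: "\<bar>E n\<bar> - \<epsilon> \<le> exp (- c * (h n - h N)) * \<bar>E N\<bar>" if "n \<ge> N" for n
    using that
  proof (induction n rule: dec_induct)
    case base
    then show ?case using \<epsilon> by simp
  next
    case (step n)
    have f: "0 \<le> 1 - c / Suc n" "1 - c / Suc n \<le> exp (- (c / Suc n))"
      using step N c exp_ge_add_one_self[of "- (c / Suc n)"] by (simp_all add: field_simps)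
    have "\<bar>E (Suc n)\<bar> - \<epsilon> \<le> (1 - c / Suc n) * (\<bar>E n\<bar> - \<epsilon>)"
      using shrink step by simp
    also have "\<dots> \<le> (1 - c / Suc n) * (exp (- c * (h n - h N)) * \<bar>E N\<bar>)"
      using step f by (intro mult_left_mono) auto
    also have "\<dots> \<le> exp (- (c / Suc n)) * (exp (- c * (h n - h N)) * \<bar>E N\<bar>)"
      using f by (intro mult_right_mono) auto
    also have "\<dots> = exp (- (c / Suc n) + - c * (h n - h N)) * \<bar>E N\<bar>"
      by (simp only: exp_add mult.assoc)
    also have "- (c / Suc n) + - c * (h n - h N) = - c * (h (Suc n) - h N)"
      by (simp add: h_Suc ring_distribs del: of_nat_Suc)
    finally show ?case .
  qed
  have h_top: "filterlim h at_top sequentially"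
  proof -
    have "filterlim (\<lambda>n. harm n :: real) at_top sequentially" by (rule harm_at_top)
    moreover have "h = (\<lambda>n. harm n)" by (auto simp: h_def harm_def inverse_eq_divide)
    ultimately show ?thesis by simp
  qed
  have "filterlim (\<lambda>n. c * h n) at_top sequentially"
    by (rule filterlim_tendsto_pos_mult_at_top[OF tendsto_const c h_top])
  then have "(\<lambda>n. exp (- (c * h n))) \<longlonglongrightarrow> 0"
    by (intro filterlim_compose[OF exp_at_bot] filterlim_compose[OF filterlim_uminus_at_bot_at_top])
  from tendsto_mult[OF this tendsto_const[of "exp (c * h N) * \<bar>E N\<bar>"]]
  have "(\<lambda>n. exp (- (c * h n)) * (exp (c * h N) * \<bar>E N\<bar>)) \<longlonglongrightarrow> 0" by simp
  moreover have "exp (- (c * h n)) * (exp (c * h N) * \<bar>E N\<bar>) = exp (- c * (h n - h N)) * \<bar>E N\<bar>" for n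
    unfolding mult.assoc[symmetric] exp_add[symmetric] by (simp add: ring_distribs)
  ultimately have "(\<lambda>n. exp (- c * (h n - h N)) * \<bar>E N\<bar>) \<longlonglongrightarrow> 0" by simp
  from LIMSEQ_D[OF this \<epsilon>] obtain N1 where
    N1: "\<And>n. n \<ge> N1 \<Longrightarrow> exp (- c * (h n - h N)) * \<bar>E N\<bar> < \<epsilon>" by auto
  show "\<exists>no. \<forall>n\<ge>no. norm (E n - 0) < r"
  proof (intro exI allI impI)
    fix n assume "n \<ge> max N N1"
    then show "norm (E n - 0) < r"
      using bound[of n] N1[of n] by (simp add: \<epsilon>_def)
  qed
qed

text \<open>Subtracting the partial sums of \<open>d\<close> turns a summable perturbation into one
  that is divided by \<open>Suc n\<close>. After a further shift by a constant this error tends to 0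
  and the contraction lemma applies.\<close>

lemma averaged_recursion_tendsto:
  fixes A b d :: "nat \<Rightarrow> real" and c \<beta> :: real
  assumes c: "c > 0"
    and rec: "\<And>n. n \<ge> 1 \<Longrightarrow> A (Suc n) = A n * (1 - c / Suc n) + b (Suc n) / Suc n + d n"
    and b: "b \<longlonglongrightarrow> \<beta>"
    and d: "summable d"
  shows "A \<longlonglongrightarrow> \<beta> / c"
proof -
  define s where "s n = (\<Sum>k<n. d k)" for n
  have s: "s \<longlonglongrightarrow> suminf d"
    unfolding s_def using summable_LIMSEQ[OF d] .
  have s': "(\<lambda>n. s (n - 1)) \<longlonglongrightarrow> suminf d"
    by (rule LIMSEQ_offset[of _ 1]) (use s in simp)
  \<comment> \<open>This constant solves \<open>\<beta> - c * suminf d - c * l = 0\<close>, so the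
    new error tends to 0. At \<open>Suc n\<close> that error contains \<open>s n\<close>, hence the
    shifted index \<open>n - 1\<close> below.\<close>
  define l where "l = \<beta> / c - suminf d"
  have "(\<lambda>n. A n - s n - l) \<longlonglongrightarrow> 0"
  proof (rule contraction_step_tendsto_0[OF c])
    show "(\<lambda>n. b n - c * s (n - 1) - c * l) \<longlonglongrightarrow> 0"
      using b s' c by (auto intro!: tendsto_eq_intros simp: l_def field_simps)
    show "A (Suc n) - s (Suc n) - l = (A n - s n - l) * (1 - c / Suc n)
        + (b (Suc n) - c * s (Suc n - 1) - c * l) / Suc n" if "n \<ge> 1" for n
      unfolding rec[OF that] by (simp add: s_def divide_inverse algebra_simps del: of_nat_Suc)
  qed
  from tendsto_add[OF this tendsto_add[OF s tendsto_const[of l]]]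
  show ?thesis by (simp add: l_def)
qed

section \<open>Sums over truncation levels\<close>

text \<open>The terms telescope by \<open>1 / k^2 \<le> 2 / k - 2 / (k + 1)\<close>, and the first
  \<open>k \<ge> x\<close> has \<open>2 * x^2 / k \<le> 2 * x\<close>. Keeping the subtracted
  remainder makes the bound inductive.\<close>

lemma sum_truncated_square_le_strong:
  fixes x :: real
  assumes "x \<ge> 0"
  shows "(\<Sum>k=1..n. (if x \<le> real k then x\<^sup>2 / (real k)\<^sup>2 else 0))
    \<le> (if x \<le> real n then 2 * x - 2 * x\<^sup>2 / real (n + 1) else 0)"
proof (induction n)
  case 0
  then show ?case using assms by auto
next
  case (Suc n)
  define y where "y = real n + 1"
  have y: "y \<ge> 1" by (simp add: y_def)
  have key: "x\<^sup>2 / y\<^sup>2 \<le> 2 * x\<^sup>2 / y - 2 * x\<^sup>2 / (y + 1)"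
  proof -
    have "1 / y\<^sup>2 \<le> 2 / y - 2 / (y + 1)"
      using y by (simp add: divide_simps power2_eq_square)
    from mult_left_mono[OF this, of "x\<^sup>2"] show ?thesis by (simp add: algebra_simps)
  qed
  show ?case
  proof (cases "x \<le> y")
    case True
    have "2 * x\<^sup>2 / y \<le> 2 * x"
      using True y assms by (simp add: field_simps power2_eq_square mult_left_mono)
    then show ?thesis
      using Suc key True by (auto simp: y_def algebra_simps split: if_splits)
  next
    case False
    then show ?thesis using Suc by (auto simp: y_def algebra_simps split: if_splits)
  qed
qed

lemma sum_truncated_square_le:
  fixes x :: real
  assumes "x \<ge> 0"
  shows "(\<Sum>k=1..n. (if x \<le> real k then x\<^sup>2 / (real k)\<^sup>2 else 0)) \<le> 2 * x"
proof -
  have "0 \<le> 2 * x\<^sup>2 / real (n + 1)" by simp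
  then show ?thesis
    using assms by (intro order_trans[OF sum_truncated_square_le_strong]) (simp_all del: of_nat_add)
qed

text \<open>The minimum makes the induction work: a new term 1 appears only when
  \<open>x > Suc n\<close>, and then the minimum grows by 1 as well. At
  \<open>x = \<bar>\<xi> 1 \<omega>\<bar>\<close> it yields the Borel-Cantelli sum.\<close>

lemma sum_exceedances_le:
  fixes x :: real
  assumes "x \<ge> 0"
  shows "(\<Sum>k=1..n. (if x > real k then 1 else 0)) \<le> min x (real n)"
proof (induction n)
  case 0
  then show ?case using assms by auto
next
  case (Suc n)
  then show ?case by (auto split: if_splits)
qed

lemma square_sum_orthogonal:
  fixes f :: "'b \<Rightarrow> real"
  assumes "finite A" and "\<And>i j. i \<in> A \<Longrightarrow> j \<in> A \<Longrightarrow> i \<noteq> j \<Longrightarrow> f i * f j = 0"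
  shows "(\<Sum>i\<in>A. f i)\<^sup>2 = (\<Sum>i\<in>A. (f i)\<^sup>2)"
proof -
  have "(\<Sum>i\<in>A. f i)\<^sup>2 = (\<Sum>i\<in>A. \<Sum>j\<in>A. f i * f j)"
    by (simp add: power2_eq_square sum_product)
  also have "\<dots> = (\<Sum>i\<in>A. \<Sum>j\<in>A. if j = i then (f i)\<^sup>2 else 0)"
    using assms(2) by (intro sum.cong) (auto simp: power2_eq_square)
  also have "\<dots> = (\<Sum>i\<in>A. (f i)\<^sup>2)" using assms(1) by simp
  finally show ?thesis .
qed

subsection \<open>Almost sure convergence of sums of martingale differences\<close>

lemma (in prob_space) integrable_bounded:
  fixes f :: "'a \<Rightarrow> real"
  assumes "f \<in> borel_measurable M" "\<And>\<omega>. \<omega> \<in> space M \<Longrightarrow> \<bar>f \<omega>\<bar> \<le> C"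
  shows "integrable M f"
  using assms by (intro integrable_const_bound[of _ C]) (auto intro: AE_I2)

lemma (in prob_space) integrable_bounded_square:
  fixes f :: "'a \<Rightarrow> real"
  assumes [measurable]: "f \<in> borel_measurable M" and C: "\<And>\<omega>. \<omega> \<in> space M \<Longrightarrow> \<bar>f \<omega>\<bar> \<le> C"
  shows "integrable M (\<lambda>\<omega>. (f \<omega>)\<^sup>2)"
proof (rule integrable_bounded)
  fix \<omega> assume "\<omega> \<in> space M"
  then have "\<bar>f \<omega>\<bar> \<le> \<bar>C\<bar>" using C by fastforce
  then show "\<bar>(f \<omega>)\<^sup>2\<bar> \<le> C\<^sup>2" by (simp add: abs_le_square_iff)
qed measurable

text \<open>The condition that \<open>D n\<close> has conditional mean 0 given \<open>F n\<close> is
  encoded as orthogonality to all bounded \<open>F n\<close>-measurable variables, which avoids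
  conditional expectations. Boundedness of each \<open>D n\<close> makes the products
  integrable.\<close>

locale bounded_martingale_differences = prob_space M
  for M :: "'a measure" and F :: "nat \<Rightarrow> 'a measure" and D :: "nat \<Rightarrow> 'a \<Rightarrow> real" +
  assumes subalg: "\<And>n. subalgebra M (F n)"
    and F_mono: "\<And>m n. m \<le> n \<Longrightarrow> sets (F m) \<subseteq> sets (F n)"
    and adapted: "\<And>n. D n \<in> borel_measurable (F (Suc n))"
    and bounded: "\<And>n. \<exists>C. \<forall>\<omega>\<in>space M. \<bar>D n \<omega>\<bar> \<le> C"
    and orthogonal: "\<And>n Y. Y \<in> borel_measurable (F n) \<Longrightarrow>
      (\<exists>C. \<forall>\<omega>\<in>space M. \<bar>Y \<omega>\<bar> \<le> C) \<Longrightarrow> expectation (\<lambda>\<omega>. Y \<omega> * D n \<omega>) = 0"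
begin

lemma space_F [simp]: "space (F n) = space M"
  using subalg by (simp add: subalgebra_def)

lemma measurable_F_mono: "f \<in> borel_measurable (F m) \<Longrightarrow> m \<le> n \<Longrightarrow> f \<in> borel_measurable (F n)"
  by (rule measurable_from_subalg[of "F n" "F m"]) (simp_all add: subalgebra_def F_mono)

lemma measurable_F: "f \<in> borel_measurable (F m) \<Longrightarrow> f \<in> borel_measurable M"
  using measurable_from_subalg[OF subalg] by blast

lemma D_measurable: "i < n \<Longrightarrow> D i \<in> borel_measurable (F n)"
  using adapted measurable_F_mono[of "D i" "Suc i" n] by auto

lemma D_rv [measurable]: "D n \<in> borel_measurable M"
  using adapted measurable_F by blast

lemma partial_sum_measurable: "n \<le> k \<Longrightarrow> (\<lambda>\<omega>. \<Sum>i<n. D i \<omega>) \<in> borel_measurable (F k)"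
  by (intro borel_measurable_sum) (auto intro: D_measurable)

text \<open>Increments of a martingale transform are orthogonal: the sum so far times
  \<open>G n\<close> is bounded and \<open>F n\<close>-measurable, so its product with
  \<open>D n\<close> has mean 0. Multipliers of size at most 1 do not increase the second
  moments.\<close>

lemma transform_second_moment:
  assumes G: "\<And>i. G i \<in> borel_measurable (F i)"
    and G1: "\<And>i \<omega>. \<bar>G i \<omega>\<bar> \<le> 1"
    and mn: "m \<le> n"
  shows "expectation (\<lambda>\<omega>. (\<Sum>i\<in>{m..<n}. G i \<omega> * D i \<omega>)\<^sup>2)
    \<le> (\<Sum>i\<in>{m..<n}. expectation (\<lambda>\<omega>. (D i \<omega>)\<^sup>2))"
  using mn
proof (induction n rule: dec_induct)
  case base
  then show ?case by simp
next
  case (step n)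
  define Q where "Q \<omega> = (\<Sum>i\<in>{m..<n}. G i \<omega> * D i \<omega>)" for \<omega>
  have G_M [measurable]: "G i \<in> borel_measurable M" for i using G measurable_F by blast
  have Q: "Q \<in> borel_measurable (F n)" unfolding Q_def
    by (intro borel_measurable_sum borel_measurable_times)
      (auto intro: D_measurable measurable_F_mono[OF G])
  then have Q_M [measurable]: "Q \<in> borel_measurable M" using measurable_F by blast
  obtain B where B: "\<And>i \<omega>. \<omega> \<in> space M \<Longrightarrow> \<bar>D i \<omega>\<bar> \<le> B i"
    using bounded by metis
  have GD: "\<bar>G i \<omega> * D i \<omega>\<bar> \<le> B i" if "\<omega> \<in> space M" for i \<omega>
    using mult_mono[OF G1[of i \<omega>] B[OF that, of i]] by (simp add: abs_mult)
  define C where "C = (\<Sum>i\<in>{m..<n}. B i)"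
  have QC: "\<bar>Q \<omega>\<bar> \<le> C" if "\<omega> \<in> space M" for \<omega>
    unfolding Q_def C_def using GD[OF that] by (intro order_trans[OF sum_abs] sum_mono)
  have int_Q2: "integrable M (\<lambda>\<omega>. (Q \<omega>)\<^sup>2)"
    using QC by (intro integrable_bounded_square) auto
  have int_D2: "integrable M (\<lambda>\<omega>. (D n \<omega>)\<^sup>2)"
    using B by (intro integrable_bounded_square) auto
  have int_GD2: "integrable M (\<lambda>\<omega>. (G n \<omega> * D n \<omega>)\<^sup>2)"
    using GD by (intro integrable_bounded_square[of _ "B n"]) auto
  have QGC: "\<bar>Q \<omega> * G n \<omega>\<bar> \<le> C" if "\<omega> \<in> space M" for \<omega>
    using mult_mono[OF QC[OF that] G1[of n \<omega>]] QC[OF that] by (simp add: abs_mult)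
  have QGDC: "\<bar>Q \<omega> * G n \<omega> * D n \<omega>\<bar> \<le> C * B n" if "\<omega> \<in> space M" for \<omega>
    using mult_mono[OF QGC[OF that] B[OF that, of n]] QC[OF that]
    by (simp add: abs_mult)
  have int_cross: "integrable M (\<lambda>\<omega>. Q \<omega> * G n \<omega> * D n \<omega>)"
    using QGDC by (intro integrable_bounded) auto
  have cross: "expectation (\<lambda>\<omega>. Q \<omega> * G n \<omega> * D n \<omega>) = 0"
    using QGC by (intro orthogonal borel_measurable_times Q G) auto
  have "expectation (\<lambda>\<omega>. (\<Sum>i\<in>{m..<Suc n}. G i \<omega> * D i \<omega>)\<^sup>2) =
      expectation (\<lambda>\<omega>. (Q \<omega>)\<^sup>2 + 2 * (Q \<omega> * G n \<omega> * D n \<omega>) + (G n \<omega> * D n \<omega>)\<^sup>2)"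
    using step by (intro Bochner_Integration.integral_cong) (auto simp: Q_def power2_sum)
  also have "\<dots> = expectation (\<lambda>\<omega>. (Q \<omega>)\<^sup>2) + expectation (\<lambda>\<omega>. (G n \<omega> * D n \<omega>)\<^sup>2)"
    using int_Q2 int_cross int_GD2 cross by simp
  also have "expectation (\<lambda>\<omega>. (G n \<omega> * D n \<omega>)\<^sup>2) \<le> expectation (\<lambda>\<omega>. (D n \<omega>)\<^sup>2)"
  proof (rule integral_mono[OF int_GD2 int_D2])
    fix \<omega>
    have "(G n \<omega>)\<^sup>2 \<le> 1" using G1[of n \<omega>] by (simp add: abs_square_le_1)
    then show "(G n \<omega> * D n \<omega>)\<^sup>2 \<le> (D n \<omega>)\<^sup>2"
      by (simp add: power_mult_distrib mult_left_le_one_le)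
  qed
  finally show ?case using step by (simp add: Q_def)
qed

text \<open>Kolmogorov's inequality. If the partial sums leave the
  \<open>\<epsilon>\<close>-neighbourhood, the stopped sum \<open>Q\<close> stays at its exit value,
  so \<open>\<bar>Q \<omega>\<bar> \<ge> \<epsilon>\<close>. Markov's inequality for the square of
  \<open>Q\<close> concludes, as \<open>Q\<close> is a transform by 0-1 multipliers.\<close>

lemma maximal_inequality:
  assumes mn: "m \<le> n" and \<epsilon>: "\<epsilon> > 0"
  shows "prob {\<omega>\<in>space M. \<exists>k\<in>{m..n}. \<bar>(\<Sum>i<k. D i \<omega>) - (\<Sum>i<m. D i \<omega>)\<bar> \<ge> \<epsilon>}
    \<le> (\<Sum>i\<in>{m..<n}. expectation (\<lambda>\<omega>. (D i \<omega>)\<^sup>2)) / \<epsilon>\<^sup>2"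
proof -
  define S where "S k \<omega> = (\<Sum>i<k. D i \<omega>)" for k \<omega>
  have S_F: "S n \<in> borel_measurable (F k)" if "n \<le> k" for n k
    unfolding S_def using partial_sum_measurable[OF that] .
  have S_M [measurable]: "S k \<in> borel_measurable M" for k
    using S_F[of k k] measurable_F by blast
  \<comment> \<open>Stop the partial sums when they first leave the \<open>\<epsilon>\<close>-neighbourhood of their value at \<open>m\<close>.\<close>
  define G :: "nat \<Rightarrow> 'a \<Rightarrow> real" where
    "G i \<omega> = (if \<forall>j\<in>{m..i}. \<bar>S j \<omega> - S m \<omega>\<bar> < \<epsilon> then 1 else 0)" for i \<omega>
  have G: "G i \<in> borel_measurable (F i)" for i
  proof (cases "m \<le> i")
    case True
    have "{\<omega> \<in> space (F i). \<forall>j\<in>{m..i}. \<bar>S j \<omega> - S m \<omega>\<bar> < \<epsilon>} \<in> sets (F i)"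
    proof (rule sets.sets_Collect_finite_All)
      fix j assume j: "j \<in> {m..i}"
      have [measurable]: "S j \<in> borel_measurable (F i)" "S m \<in> borel_measurable (F i)"
        using j by (auto intro: S_F)
      show "{\<omega> \<in> space (F i). \<bar>S j \<omega> - S m \<omega>\<bar> < \<epsilon>} \<in> sets (F i)" by measurable
    qed auto
    then show ?thesis unfolding G_def by (intro measurable_If) auto
  qed (simp add: G_def[abs_def])
  have [measurable]: "G i \<in> borel_measurable M" for i using G measurable_F by blast
  define Q where "Q \<omega> = (\<Sum>i\<in>{m..<n}. G i \<omega> * D i \<omega>)" for \<omega>
  have [measurable]: "Q \<in> borel_measurable M" unfolding Q_def by measurable
  \<comment> \<open>At the first exit time \<open>k\<close>, \<open>G i\<close> is 1 for
    \<open>m \<le> i < k\<close> and 0 from \<open>k\<close> on, so \<open>Q\<close> equals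
    \<open>S k - S m\<close>. Since \<open>S i\<close> sums \<open>D\<close> only below
    \<open>i\<close>, \<open>G i\<close> is decided before \<open>D i\<close> is added.\<close>
  have exit: "\<bar>Q \<omega>\<bar> \<ge> \<epsilon>" if ex: "\<exists>k\<in>{m..n}. \<bar>S k \<omega> - S m \<omega>\<bar> \<ge> \<epsilon>" for \<omega>
  proof -
    define P where "P k \<longleftrightarrow> k \<in> {m..n} \<and> \<bar>S k \<omega> - S m \<omega>\<bar> \<ge> \<epsilon>" for k
    define k where "k = Least P"
    have "\<exists>k. P k" using ex by (auto simp: P_def)
    then have "P k" unfolding k_def by (rule LeastI_ex)
    then have k: "k \<in> {m..n}" "\<bar>S k \<omega> - S m \<omega>\<bar> \<ge> \<epsilon>" by (auto simp: P_def)
    have before: "\<bar>S j \<omega> - S m \<omega>\<bar> < \<epsilon>" if "m \<le> j" "j < k" for j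
      using not_less_Least[of j P, folded k_def] that k by (auto simp: P_def)
    have "Q \<omega> = (\<Sum>i\<in>{m..<k}. G i \<omega> * D i \<omega>) + (\<Sum>i\<in>{k..<n}. G i \<omega> * D i \<omega>)"
      unfolding Q_def using k by (intro sum.atLeastLessThan_concat[symmetric]) auto
    also have "(\<Sum>i\<in>{k..<n}. G i \<omega> * D i \<omega>) = 0"
    proof (rule sum.neutral, rule ballI)
      fix i assume "i \<in> {k..<n}"
      then have "k \<in> {m..i}" "\<not> \<bar>S k \<omega> - S m \<omega>\<bar> < \<epsilon>" using k by auto
      then have "G i \<omega> = 0" unfolding G_def by (metis (mono_tags))
      then show "G i \<omega> * D i \<omega> = 0" by simp
    qed
    also have "(\<Sum>i\<in>{m..<k}. G i \<omega> * D i \<omega>) = (\<Sum>i\<in>{m..<k}. D i \<omega>)"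
      using before by (intro sum.cong) (auto simp: G_def)
    also have "\<dots> = S k \<omega> - S m \<omega>"
      using sum_diff_nat_ivl[of 0 m k "\<lambda>i. D i \<omega>"] k by (simp add: S_def atLeast0LessThan)
    finally show ?thesis using k by simp
  qed
  have int_Q2: "integrable M (\<lambda>\<omega>. (Q \<omega>)\<^sup>2)"
  proof -
    obtain B where B: "\<And>i \<omega>. \<omega> \<in> space M \<Longrightarrow> \<bar>D i \<omega>\<bar> \<le> B i"
      using bounded by metis
    have "\<bar>Q \<omega>\<bar> \<le> (\<Sum>i\<in>{m..<n}. B i)" if "\<omega> \<in> space M" for \<omega>
      unfolding Q_def using order_trans[OF abs_ge_zero B[OF that]] B[OF that]
      by (intro order_trans[OF sum_abs] sum_mono) (auto simp: G_def)
    then show ?thesis by (intro integrable_bounded_square) auto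
  qed
  have "prob {\<omega>\<in>space M. \<exists>k\<in>{m..n}. \<bar>S k \<omega> - S m \<omega>\<bar> \<ge> \<epsilon>} \<le> prob {\<omega>\<in>space M. (Q \<omega>)\<^sup>2 \<ge> \<epsilon>\<^sup>2}"
    using exit \<epsilon> by (intro finite_measure_mono) (auto simp flip: abs_le_square_iff)
  also have "\<dots> \<le> expectation (\<lambda>\<omega>. (Q \<omega>)\<^sup>2) / \<epsilon>\<^sup>2"
    using \<epsilon> by (intro integral_Markov_inequality_measure[OF int_Q2, of "{}"]) auto
  also have "\<dots> \<le> (\<Sum>i\<in>{m..<n}. expectation (\<lambda>\<omega>. (D i \<omega>)\<^sup>2)) / \<epsilon>\<^sup>2"
    unfolding Q_def
    by (intro divide_right_mono transform_second_moment[OF G _ mn]) (auto simp: G_def)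
  finally show ?thesis by (simp add: S_def)
qed

text \<open>\<open>E \<epsilon> m\<close> is the event that the partial sums move by at least
  \<open>\<epsilon>\<close> after time \<open>m\<close>. Its probability is bounded by a tail of the
  convergent variance series, so all \<open>E \<epsilon> m\<close> together occur with probability
  0, and the partial sums are almost surely Cauchy.\<close>

lemma AE_summable:
  assumes summable: "summable (\<lambda>n. expectation (\<lambda>\<omega>. (D n \<omega>)\<^sup>2))"
  shows "AE \<omega> in M. summable (\<lambda>n. D n \<omega>)"
proof -
  define S where "S k \<omega> = (\<Sum>i<k. D i \<omega>)" for k \<omega>
  have S_M [measurable]: "S k \<in> borel_measurable M" for k unfolding S_def by measurable
  define v where "v n = expectation (\<lambda>\<omega>. (D n \<omega>)\<^sup>2)" for n
  have v: "v n \<ge> 0" "summable v" for n using summable by (auto simp: v_def[abs_def])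
  define E where "E \<epsilon> m = {\<omega>\<in>space M. \<exists>k\<ge>m. \<bar>S k \<omega> - S m \<omega>\<bar> \<ge> \<epsilon>}" for \<epsilon> m
  have E_M [measurable]: "E \<epsilon> m \<in> events" for \<epsilon> m unfolding E_def by measurable
  \<comment> \<open>The maximal inequality covers a finite horizon \<open>m + n\<close>; continuity
    from below along increasing \<open>n\<close> extends it to all later times.\<close>
  have tail: "prob (E \<epsilon> m) \<le> (\<Sum>i. v (i + m)) / \<epsilon>\<^sup>2" if \<epsilon>: "\<epsilon> > 0" for \<epsilon> m
  proof (rule LIMSEQ_le_const2)
    let ?B = "\<lambda>n. {\<omega>\<in>space M. \<exists>k\<in>{m..m+n}. \<bar>S k \<omega> - S m \<omega>\<bar> \<ge> \<epsilon>}"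
    have "(\<lambda>n. prob (?B n)) \<longlonglongrightarrow> prob (\<Union>n. ?B n)"
    proof (rule finite_Lim_measure_incseq)
      show "range ?B \<subseteq> events" by auto
      show "incseq ?B"
        unfolding incseq_def by (intro allI impI subsetI) fastforce
    qed
    moreover have "(\<Union>n. ?B n) = E \<epsilon> m"
    proof (intro equalityI subsetI)
      fix \<omega> assume "\<omega> \<in> E \<epsilon> m"
      then obtain k where "\<omega> \<in> space M" "k \<ge> m" "\<bar>S k \<omega> - S m \<omega>\<bar> \<ge> \<epsilon>" by (auto simp: E_def)
      then show "\<omega> \<in> (\<Union>n. ?B n)" by (intro UN_I[of "k - m"]) auto
    qed (auto simp: E_def)
    ultimately show "(\<lambda>n. prob (?B n)) \<longlonglongrightarrow> prob (E \<epsilon> m)" by simp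
    show "\<exists>N. \<forall>n\<ge>N. prob (?B n) \<le> (\<Sum>i. v (i + m)) / \<epsilon>\<^sup>2"
    proof (intro exI allI impI)
      fix n
      have "prob (?B n) \<le> (\<Sum>i\<in>{m..<m+n}. v i) / \<epsilon>\<^sup>2"
        using maximal_inequality[of m "m + n", OF _ \<epsilon>] by (simp add: S_def v_def)
      also have "(\<Sum>i\<in>{m..<m+n}. v i) = (\<Sum>i<n. v (i + m))"
        using sum.shift_bounds_nat_ivl[of v 0 m n] by (simp add: atLeast0LessThan add.commute)
      also have "\<dots> \<le> (\<Sum>i. v (i + m))"
        using v by (intro sum_le_suminf summable_ignore_initial_segment) auto
      finally show "prob (?B n) \<le> (\<Sum>i. v (i + m)) / \<epsilon>\<^sup>2" by (simp add: divide_right_mono)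
    qed
  qed
  have null: "AE \<omega> in M. \<exists>m. \<forall>k\<ge>m. \<bar>S k \<omega> - S m \<omega>\<bar> < \<epsilon>" if \<epsilon>: "\<epsilon> > 0" for \<epsilon>
  proof -
    have "prob (\<Inter>m. E \<epsilon> m) \<le> 0"
    proof (rule LIMSEQ_le_const)
      show "(\<lambda>m. (\<Sum>i. v (i + m)) / \<epsilon>\<^sup>2) \<longlonglongrightarrow> 0"
        using tendsto_divide[OF suminf_exist_split2[OF v(2)] tendsto_const[of "\<epsilon>\<^sup>2"]] \<epsilon> by simp
      show "\<exists>N. \<forall>m\<ge>N. prob (\<Inter>m. E \<epsilon> m) \<le> (\<Sum>i. v (i + m)) / \<epsilon>\<^sup>2"
      proof (intro exI allI impI)
        fix m
        have "prob (\<Inter>m. E \<epsilon> m) \<le> prob (E \<epsilon> m)" by (intro finite_measure_mono) auto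
        then show "prob (\<Inter>m. E \<epsilon> m) \<le> (\<Sum>i. v (i + m)) / \<epsilon>\<^sup>2" using tail[OF \<epsilon>, of m] by simp
      qed
    qed
    then have "prob (\<Inter>m. E \<epsilon> m) = 0" by (simp add: measure_le_0_iff)
    then have "AE \<omega> in M. \<omega> \<notin> (\<Inter>m. E \<epsilon> m)"
      by (subst (asm) prob_eq_0) auto
    then show ?thesis
    proof (rule AE_mp, intro AE_I2 impI)
      fix \<omega> assume "\<omega> \<in> space M" "\<omega> \<notin> (\<Inter>m. E \<epsilon> m)"
      then show "\<exists>m. \<forall>k\<ge>m. \<bar>S k \<omega> - S m \<omega>\<bar> < \<epsilon>" by (simp add: E_def) (meson not_le)
    qed
  qed
  \<comment> \<open>Countably many radii suffice for the Cauchy property, so the exceptional null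
    sets can be united.\<close>
  have "AE \<omega> in M. \<forall>j. \<exists>m. \<forall>k\<ge>m. \<bar>S k \<omega> - S m \<omega>\<bar> < 1 / real (Suc j)"
    unfolding AE_all_countable by (intro allI null) simp
  then show ?thesis
  proof (rule AE_mp, intro AE_I2 impI)
    fix \<omega> assume *: "\<forall>j. \<exists>m. \<forall>k\<ge>m. \<bar>S k \<omega> - S m \<omega>\<bar> < 1 / real (Suc j)"
    have "Cauchy (\<lambda>k. S k \<omega>)"
      unfolding Cauchy_altdef2
    proof (intro allI impI)
      fix e :: real assume "e > 0"
      then obtain j where j: "1 / real (Suc j) < e" using nat_approx_posE by blast
      obtain m where m: "\<And>k. k \<ge> m \<Longrightarrow> \<bar>S k \<omega> - S m \<omega>\<bar> < 1 / real (Suc j)" using * by blast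
      have "dist (S k \<omega>) (S m \<omega>) < e" if "k \<ge> m" for k
        using less_trans[OF m[OF that] j] by (simp add: dist_real_def)
      then show "\<exists>N. \<forall>n\<ge>N. dist (S n \<omega>) (S N \<omega>) < e" by blast
    qed
    then have "convergent (\<lambda>k. S k \<omega>)" by (rule Cauchy_convergent)
    then show "summable (\<lambda>n. D n \<omega>)" unfolding summable_iff_convergent S_def .
  qed
qed

end

subsection \<open>Independence\<close>

text \<open>Independence between whole sequences and within each sequence combine to joint
  independence of all entries: a finite subfamily is grouped by sequence, its probability factors
  over the groups by \<open>outer\<close>, and each group factors by \<open>inner\<close>.\<close>

lemma (in prob_space) indep_vars_nested:
  assumes outer: "indep_vars (\<lambda>s. PiM (K s) (N s)) (\<lambda>s \<omega>. \<lambda>k\<in>K s. Z s k \<omega>) S"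
    and inner: "\<And>s. s \<in> S \<Longrightarrow> indep_vars (N s) (Z s) (K s)"
  shows "indep_vars (\<lambda>(s, k). N s k) (\<lambda>(s, k). Z s k) (Sigma S K)"
  unfolding indep_vars_def2
proof (intro conjI ballI)
  show "random_variable (case i of (s, k) \<Rightarrow> N s k) (case i of (s, k) \<Rightarrow> Z s k)" if "i \<in> Sigma S K" for i
    using that inner by (auto simp: indep_vars_def2)
  then have rv: "Z s k \<in> measurable M (N s k)" if "s \<in> S" "k \<in> K s" for s k
    using that by force
  let ?E = "\<lambda>i. {(case i of (s, k) \<Rightarrow> Z s k) -` A \<inter> space M |A. A \<in> sets (case i of (s, k) \<Rightarrow> N s k)}"
  show "indep_sets ?E (Sigma S K)"
  proof (rule indep_setsI)
    show "?E i \<subseteq> events" if "i \<in> Sigma S K" for i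
      using that rv by (auto intro: measurable_sets)
  next
    fix A and J assume J: "J \<noteq> {}" "J \<subseteq> Sigma S K" "finite J" and "\<forall>j\<in>J. A j \<in> ?E j"
    then have "\<exists>B. A (s, k) = Z s k -` B \<inter> space M \<and> B \<in> sets (N s k)" if "(s, k) \<in> J" for s k
      using that by force
    then obtain B where AB: "\<And>s k. (s, k) \<in> J \<Longrightarrow> A (s, k) = Z s k -` B (s, k) \<inter> space M \<and> B (s, k) \<in> sets (N s k)"
      by (metis (no_types) case_prod_conv)
    then have A: "A (s, k) = Z s k -` B (s, k) \<inter> space M"
      and B: "B (s, k) \<in> sets (N s k)" if "(s, k) \<in> J" for s k
      using that by blast+
    define R where "R s = {k. (s, k) \<in> J}" for s
    define T where "T = fst ` J"
    have J_eq: "J = Sigma T R" unfolding T_def R_def by force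
    have T: "finite T" "T \<noteq> {}" "T \<subseteq> S" using J by (auto simp: T_def)
    have R: "finite (R s)" "R s \<subseteq> K s" for s
    proof -
      have "R s \<subseteq> snd ` J" by (force simp: R_def)
      then show "finite (R s)" using J(3) by (meson finite_imageI finite_subset)
      show "R s \<subseteq> K s" using J(2) by (auto simp: R_def)
    qed
    have R_ne: "R s \<noteq> {}" if "s \<in> T" for s using that by (auto simp: T_def R_def)
    \<comment> \<open>The cylinder over the finitely many coordinates \<open>R s\<close>. Its
      preimage under the whole sequence \<open>s\<close> is the intersection of the given events in
      that group, which is the form that \<open>outer\<close> can use.\<close>
    define C where "C s = prod_emb (K s) (N s) (R s) (\<Pi>\<^sub>E k\<in>R s. B (s, k))" for s
    have C: "C s \<in> sets (PiM (K s) (N s))" for s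
      unfolding C_def using R B by (intro sets_PiM_I) (auto simp: R_def)
    have pre: "(\<lambda>\<omega>. \<lambda>k\<in>K s. Z s k \<omega>) -` C s \<inter> space M = (\<Inter>k\<in>R s. A (s, k))" if s: "s \<in> T" for s
    proof -
      have "Z s k \<omega> \<in> space (N s k)" if "k \<in> K s" "\<omega> \<in> space M" for k \<omega>
        using measurable_space[OF rv] that s T by blast
      moreover have "A (s, k) = Z s k -` B (s, k) \<inter> space M" if "k \<in> R s" for k
        using A that by (auto simp: R_def)
      ultimately show ?thesis
        using R_ne[OF s] R(2)[of s] by (auto simp: C_def prod_emb_def PiE_iff subset_iff)
    qed
    have "(\<Inter>j\<in>J. A j) = (\<Inter>s\<in>T. \<Inter>k\<in>R s. A (s, k))"
      unfolding J_eq by auto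
    also have "\<dots> = (\<Inter>s\<in>T. (\<lambda>\<omega>. \<lambda>k\<in>K s. Z s k \<omega>) -` C s \<inter> space M)"
      using pre by (intro INF_cong) auto
    finally have "prob (\<Inter>j\<in>J. A j) = prob \<dots>" by simp
    also have "\<dots> = (\<Prod>s\<in>T. prob ((\<lambda>\<omega>. \<lambda>k\<in>K s. Z s k \<omega>) -` C s \<inter> space M))"
      using T C by (intro indep_varsD[OF outer]) auto
    also have "\<dots> = (\<Prod>s\<in>T. \<Prod>k\<in>R s. prob (A (s, k)))"
    proof (rule prod.cong[OF refl])
      fix s assume s: "s \<in> T"
      have "prob (\<Inter>k\<in>R s. A (s, k)) = prob (\<Inter>k\<in>R s. Z s k -` B (s, k) \<inter> space M)"
        using A by (intro arg_cong[of _ _ prob] INF_cong) (auto simp: R_def)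
      also have "\<dots> = (\<Prod>k\<in>R s. prob (Z s k -` B (s, k) \<inter> space M))"
        using s T R R_ne B by (intro indep_varsD[OF inner]) (auto simp: R_def)
      also have "\<dots> = (\<Prod>k\<in>R s. prob (A (s, k)))"
        using A by (intro prod.cong) (auto simp: R_def)
      finally show "prob ((\<lambda>\<omega>. \<lambda>k\<in>K s. Z s k \<omega>) -` C s \<inter> space M) = (\<Prod>k\<in>R s. prob (A (s, k)))"
        using pre[OF s] by simp
    qed
    also have "\<dots> = (\<Prod>j\<in>J. prob (A j))"
      unfolding J_eq using T R by (simp add: prod.Sigma)
    finally show "prob (\<Inter>j\<in>J. A j) = (\<Prod>j\<in>J. prob (A j))" .
  qed
qed

section \<open>Sigma-algebras generated by subfamilies\<close>

text \<open>Pulling back the product sigma-algebra along the restricted family gives the same sets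
  as those in which independence of two restricted families is expressed.\<close>

definition generated_algebra :: "'a measure \<Rightarrow> ('i \<Rightarrow> 'a \<Rightarrow> real) \<Rightarrow> 'i set \<Rightarrow> 'a measure" where
  "generated_algebra M W I = vimage_algebra (space M) (\<lambda>\<omega>. \<lambda>i\<in>I. W i \<omega>) (PiM I (\<lambda>_. borel))"

lemma space_generated_algebra [simp]: "space (generated_algebra M W I) = space M"
  by (simp add: generated_algebra_def)

lemma sets_generated_algebra:
  "sets (generated_algebra M W I) = {(\<lambda>\<omega>. \<lambda>i\<in>I. W i \<omega>) -` A \<inter> space M | A. A \<in> sets (PiM I (\<lambda>_. borel))}"
  unfolding generated_algebra_def
  by (rule sets_vimage_algebra2) (auto simp: space_PiM)

lemma measurable_generated_algebra:
  assumes "i \<in> I"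
  shows "W i \<in> borel_measurable (generated_algebra M W I)"
proof -
  have "(\<lambda>\<omega>. \<lambda>i\<in>I. W i \<omega>) \<in> measurable (generated_algebra M W I) (PiM I (\<lambda>_. borel))"
    unfolding generated_algebra_def by (rule measurable_vimage_algebra1) (auto simp: space_PiM)
  from measurable_compose[OF this measurable_component_singleton[OF assms]]
  show ?thesis using assms by simp
qed

lemma generated_algebra_least:
  assumes "space N = space M" and "\<And>i. i \<in> I \<Longrightarrow> W i \<in> borel_measurable N"
  shows "sets (generated_algebra M W I) \<subseteq> sets N"
proof -
  have "(\<lambda>\<omega>. \<lambda>i\<in>I. W i \<omega>) \<in> measurable N (PiM I (\<lambda>_. borel))"
    using assms by (intro measurable_restrict) auto
  then show ?thesis
    unfolding sets_generated_algebra using assms(1) by (auto dest: measurable_sets)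
qed

lemma generated_algebra_mono:
  "I \<subseteq> J \<Longrightarrow> sets (generated_algebra M W I) \<subseteq> sets (generated_algebra M W J)"
  by (rule generated_algebra_least) (auto intro: measurable_generated_algebra)

lemma subalgebra_generated_algebra:
  "(\<And>i. i \<in> I \<Longrightarrow> W i \<in> borel_measurable M) \<Longrightarrow> subalgebra M (generated_algebra M W I)"
  unfolding subalgebra_def by (simp add: generated_algebra_least)

text \<open>Disjoint subfamilies of an independent family generate independent sigma-algebras, and
  \<open>Y\<close> and \<open>f (W i \<omega>)\<close> are measurable for those of \<open>I\<close>
  and \<open>{i}\<close>. This product rule takes the place of conditioning on the past.\<close>

lemma (in prob_space) expectation_mult_fresh:
  fixes Y :: "'a \<Rightarrow> real" and f :: "real \<Rightarrow> real"
  assumes indep: "indep_vars (\<lambda>_. borel) W S"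
    and I: "I \<subseteq> S" and i: "i \<in> S" "i \<notin> I"
    and Y: "Y \<in> borel_measurable (generated_algebra M W I)" "integrable M Y"
    and f: "f \<in> borel_measurable borel" "integrable M (\<lambda>\<omega>. f (W i \<omega>))"
  shows "expectation (\<lambda>\<omega>. Y \<omega> * f (W i \<omega>)) = expectation Y * expectation (\<lambda>\<omega>. f (W i \<omega>))"
    and "integrable M (\<lambda>\<omega>. Y \<omega> * f (W i \<omega>))"
proof -
  have W: "W j \<in> borel_measurable M" if "j \<in> S" for j
    using indep that by (simp add: indep_vars_def2)
  have "indep_var (PiM I (\<lambda>_. borel)) (\<lambda>\<omega>. \<lambda>i\<in>I. W i \<omega>) (PiM {i} (\<lambda>_. borel)) (\<lambda>\<omega>. \<lambda>i\<in>{i}. W i \<omega>)"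
    using I i by (intro indep_var_restrict[OF indep]) auto
  moreover have "sigma_sets (space M) (sets (generated_algebra M W J)) = sets (generated_algebra M W J)" for J
    using sets.sigma_sets_eq[of "generated_algebra M W J"] by simp
  ultimately have ind: "indep_set (sets (generated_algebra M W I)) (sets (generated_algebra M W {i}))"
    unfolding indep_var_eq sets_generated_algebra[symmetric] by simp
  have "indep_var borel Y borel (\<lambda>\<omega>. f (W i \<omega>))"
    unfolding indep_var_eq
  proof (intro conjI)
    show "random_variable borel Y" using Y(2) by simp
    show "random_variable borel (\<lambda>\<omega>. f (W i \<omega>))" using f(2) by simp
    have "(\<lambda>\<omega>. f (W i \<omega>)) \<in> borel_measurable (generated_algebra M W {i})"
      by (rule measurable_compose[OF measurable_generated_algebra f(1)]) simp
    then have "{(\<lambda>\<omega>. f (W i \<omega>)) -` A \<inter> space M | A. A \<in> sets borel} \<subseteq> sets (generated_algebra M W {i})"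
      by (auto dest: measurable_sets)
    moreover have "{Y -` A \<inter> space M | A. A \<in> sets borel} \<subseteq> sets (generated_algebra M W I)"
      using Y(1) by (auto dest: measurable_sets)
    moreover have "A \<subseteq> sets (generated_algebra M W J) \<Longrightarrow> sigma_sets (space M) A \<subseteq> sets (generated_algebra M W J)" for A J
      using sets.sigma_sets_subset[of A "generated_algebra M W J"] by simp
    ultimately have "sigma_sets (space M) {Y -` A \<inter> space M | A. A \<in> sets borel} \<subseteq> sets (generated_algebra M W I)"
      "sigma_sets (space M) {(\<lambda>\<omega>. f (W i \<omega>)) -` A \<inter> space M | A. A \<in> sets borel} \<subseteq> sets (generated_algebra M W {i})"
      by blast+
    then show "indep_set (sigma_sets (space M) {Y -` A \<inter> space M | A. A \<in> sets borel})
      (sigma_sets (space M) {(\<lambda>\<omega>. f (W i \<omega>)) -` A \<inter> space M | A. A \<in> sets borel})"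
      using ind[unfolded indep_sets2_eq] unfolding indep_sets2_eq
      by (intro conjI ballI) (blast intro: order_trans)+
  qed
  then show "expectation (\<lambda>\<omega>. Y \<omega> * f (W i \<omega>)) = expectation Y * expectation (\<lambda>\<omega>. f (W i \<omega>))"
    and "integrable M (\<lambda>\<omega>. Y \<omega> * f (W i \<omega>))"
    using indep_var_lebesgue_integral indep_var_integrable Y(2) f(2) by blast+
qed

lemma measurable_generated_algebra_mult:
  fixes Y :: "'a \<Rightarrow> real" and f :: "real \<Rightarrow> real"
  assumes "Y \<in> borel_measurable (generated_algebra M W I)" "f \<in> borel_measurable borel"
  shows "(\<lambda>\<omega>. Y \<omega> * f (W i \<omega>)) \<in> borel_measurable (generated_algebra M W (insert i I))"
proof (rule borel_measurable_times)
  show "Y \<in> borel_measurable (generated_algebra M W (insert i I))"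
    by (rule measurable_from_subalg[OF _ assms(1)])
       (simp add: subalgebra_def generated_algebra_mono subset_insertI)
  show "(\<lambda>\<omega>. f (W i \<omega>)) \<in> borel_measurable (generated_algebra M W (insert i I))"
    by (rule measurable_compose[OF measurable_generated_algebra assms(2)]) simp
qed

text \<open>The single-variable rule is applied twice: after the first use,
  \<open>f (W i \<omega>)\<close> is absorbed into the known factor, which is measurable for
  \<open>insert i I\<close>.\<close>

lemma (in prob_space) expectation_mult_fresh2:
  fixes Y :: "'a \<Rightarrow> real" and f g :: "real \<Rightarrow> real"
  assumes indep: "indep_vars (\<lambda>_. borel) W S"
    and I: "I \<subseteq> S" and i: "i \<in> S" "i \<notin> I" and j: "j \<in> S" "j \<notin> I" "i \<noteq> j"
    and Y: "Y \<in> borel_measurable (generated_algebra M W I)" "integrable M Y"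
    and f: "f \<in> borel_measurable borel" "integrable M (\<lambda>\<omega>. f (W i \<omega>))"
    and g: "g \<in> borel_measurable borel" "integrable M (\<lambda>\<omega>. g (W j \<omega>))"
  shows "expectation (\<lambda>\<omega>. Y \<omega> * f (W i \<omega>) * g (W j \<omega>)) =
      expectation Y * expectation (\<lambda>\<omega>. f (W i \<omega>)) * expectation (\<lambda>\<omega>. g (W j \<omega>))"
    and "integrable M (\<lambda>\<omega>. Y \<omega> * f (W i \<omega>) * g (W j \<omega>))"
proof -
  note Yf = expectation_mult_fresh[OF indep I i Y f]
  have *: "insert i I \<subseteq> S" "j \<notin> insert i I" using I i j by auto
  note Yfg = expectation_mult_fresh[OF indep *(1) j(1) *(2) measurable_generated_algebra_mult[OF Y(1) f(1)] Yf(2) g]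
  show "expectation (\<lambda>\<omega>. Y \<omega> * f (W i \<omega>) * g (W j \<omega>)) =
      expectation Y * expectation (\<lambda>\<omega>. f (W i \<omega>)) * expectation (\<lambda>\<omega>. g (W j \<omega>))"
    unfolding Yfg(1) Yf(1) ..
  show "integrable M (\<lambda>\<omega>. Y \<omega> * f (W i \<omega>) * g (W j \<omega>))" by (rule Yfg(2))
qed

subsection \<open>The walk with truncated innovations\<close>

lemma (in prob_space) expectation_if_eq:
  fixes Z :: "'a \<Rightarrow> real"
  assumes [measurable]: "Z \<in> borel_measurable M"
  shows "expectation (\<lambda>\<omega>. if Z \<omega> = c then 1 else 0 :: real) = prob {\<omega>\<in>space M. Z \<omega> = c}"
proof -
  have "expectation (\<lambda>\<omega>. if Z \<omega> = c then 1 else 0 :: real) = expectation (indicator {\<omega>\<in>space M. Z \<omega> = c})"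
    by (intro Bochner_Integration.integral_cong) (auto simp: indicator_def)
  also have "\<dots> = prob {\<omega>\<in>space M. Z \<omega> = c}" by (subst Bochner_Integration.integral_indicator) auto
  finally show ?thesis .
qed

lemma borel_measurable_if_eq [measurable]:
  fixes c u v :: real
  shows "(\<lambda>x. if x = c then u else v) \<in> borel_measurable borel"
  using measurable_If_set[of "\<lambda>_. u" borel borel "\<lambda>_. v" "{c}"] by simp

definition cutoff :: "real \<Rightarrow> real \<Rightarrow> real" where
  "cutoff L x = (if \<bar>x\<bar> \<le> L then x else 0)"

lemma cutoff_measurable [measurable]: "cutoff L \<in> borel_measurable borel"
  unfolding cutoff_def[abs_def] by measurable

lemma abs_cutoff_le: "\<bar>cutoff L x\<bar> \<le> \<bar>L\<bar>" "\<bar>cutoff L x\<bar> \<le> \<bar>x\<bar>"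
  by (auto simp: cutoff_def)

lemma cutoff_square_mono: "L \<le> L' \<Longrightarrow> (cutoff L x)\<^sup>2 \<le> (cutoff L' x)\<^sup>2"
  by (auto simp: cutoff_def)

locale truncated_srrw = unbalanced_srrw M \<xi> U \<gamma> \<rho> X p \<alpha>
  for M :: "'a measure" and \<xi> U \<gamma> \<rho> X p \<alpha> +
  fixes K :: nat
  assumes integrable_\<xi>: "integrable M (\<xi> 1)"
begin

section \<open>The four sources as one independent family\<close>

text \<open>One family indexed by source and time lets a single independence statement cover all
  four sequences and lets the past be a mere set of indices.\<close>

definition W :: "source \<times> nat \<Rightarrow> 'a \<Rightarrow> real" where
  "W = (\<lambda>(s, n) \<omega>. case s of Innovation \<Rightarrow> \<xi> n \<omega> | Uniform_Index \<Rightarrow> real (U n \<omega>)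
     | Memory \<Rightarrow> \<gamma> n \<omega> | Sign \<Rightarrow> \<rho> n \<omega>)"

lemma W_simps:
  "W (Innovation, n) \<omega> = \<xi> n \<omega>" "W (Uniform_Index, n) \<omega> = real (U n \<omega>)"
  "W (Memory, n) \<omega> = \<gamma> n \<omega>" "W (Sign, n) \<omega> = \<rho> n \<omega>"
  by (simp_all add: W_def)

lemma W_eqs:
  "W (Innovation, n) = \<xi> n" "W (Uniform_Index, n) = (\<lambda>\<omega>. real (U n \<omega>))"
  "W (Memory, n) = \<gamma> n" "W (Sign, n) = \<rho> n"
  by (simp_all add: W_def)

lemma indep_W: "indep_vars (\<lambda>_. borel) W (UNIV \<times> {1..})"
proof -
  let ?Z = "\<lambda>s n \<omega>. case s of Innovation \<Rightarrow> \<xi> n \<omega> | Uniform_Index \<Rightarrow> real (U n \<omega>)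
     | Memory \<Rightarrow> \<gamma> n \<omega> | Sign \<Rightarrow> \<rho> n \<omega>"
  have "indep_vars (\<lambda>_. borel) (?Z s) {1..}" for s
    using indep_\<xi> indep_\<gamma> indep_\<rho> indep_vars_compose2[OF indep_U, of "\<lambda>_. real" "\<lambda>_. borel"]
    by (cases s) auto
  from indep_vars_nested[OF indep_sources this]
  show ?thesis by (simp add: W_def split_def)
qed

lemma W_rv: "n \<ge> 1 \<Longrightarrow> W (s, n) \<in> borel_measurable M"
  using indep_W by (simp add: indep_vars_def2)

lemma integrable_W:
  fixes q :: "real \<Rightarrow> real"
  assumes "n \<ge> 1" "q \<in> borel_measurable borel" "\<And>x. \<bar>q x\<bar> \<le> C"
  shows "integrable M (\<lambda>\<omega>. q (W (s, n) \<omega>))"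
  using assms by (intro integrable_bounded measurable_compose[OF W_rv]) auto

lemma source_rv:
  assumes "n \<ge> 1"
  shows "\<xi> n \<in> borel_measurable M" "(\<lambda>\<omega>. real (U n \<omega>)) \<in> borel_measurable M"
    "\<gamma> n \<in> borel_measurable M" "\<rho> n \<in> borel_measurable M"
  using W_rv[OF assms, of Innovation] W_rv[OF assms, of Uniform_Index]
    W_rv[OF assms, of Memory] W_rv[OF assms, of Sign]
  by (simp_all add: W_def)

text \<open>
  The innovation \<open>\<xi> n\<close> enters at time \<open>n\<close>, but \<open>U\<close>, \<open>\<gamma>\<close>, \<open>\<rho>\<close> with index \<open>n\<close> only at time \<open>n + 1\<close>.
\<close>

definition past :: "nat \<Rightarrow> (source \<times> nat) set" where
  "past n = {(s, k). 1 \<le> k \<and> (if s = Innovation then k \<le> n else k < n)}"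

abbreviation "F n \<equiv> generated_algebra M W (past n)"

lemma past_subset: "past n \<subseteq> UNIV \<times> {1..}"
  by (auto simp: past_def)

lemma past_mono: "m \<le> n \<Longrightarrow> past m \<subseteq> past n"
  by (auto simp: past_def)

lemma subalgebra_F: "subalgebra M (F n)"
  by (rule subalgebra_generated_algebra) (auto simp: past_def W_rv)

lemma F_measurable: "f \<in> borel_measurable (F n) \<Longrightarrow> f \<in> borel_measurable M"
  by (rule measurable_from_subalg[OF subalgebra_F])

text \<open>
  The innovation \<open>\<xi> n\<close> is truncated at \<open>max n K\<close>: the growth in \<open>n\<close> makes exceedances finite in number,
  and choosing \<open>K\<close> large then removes the remaining ones, so that no step is altered at all.
\<close>

definition level :: "nat \<Rightarrow> real" where "level n = real (max n K)"

definition \<eta> :: "nat \<Rightarrow> 'a \<Rightarrow> real" where "\<eta> n \<omega> = cutoff (level n) (\<xi> n \<omega>)"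

text \<open>No memory variable precedes the first step, hence the case \<open>n = 1\<close>. Testing
  \<open>\<gamma> (n - 1)\<close> against 1 instead of multiplying by it keeps \<open>fresh\<close>
  bounded for every \<open>\<omega>\<close>, also on the null set where \<open>\<gamma>\<close> is
  neither 0 nor 1.\<close>

definition fresh :: "nat \<Rightarrow> 'a \<Rightarrow> real" where
  "fresh n \<omega> = (if n = 1 \<or> \<gamma> (n - 1) \<omega> \<noteq> 1 then \<eta> n \<omega> else 0)"

text \<open>The coefficient of step \<open>j\<close> in step \<open>n + 1\<close>, as a product of
  functions of one source each, ready for factoring expectations. A sign other than 1 is read as -1,
  so its value is in \<open>{-1, 0, 1}\<close> for every \<open>\<omega>\<close>.\<close>

definition copy :: "nat \<Rightarrow> nat \<Rightarrow> 'a \<Rightarrow> real" where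
  "copy n j \<omega> = (if \<gamma> n \<omega> = 1 then 1 else 0) * (2 * (if \<rho> n \<omega> = 1 then 1 else 0) - 1)
     * (if real (U n \<omega>) = real j then 1 else 0)"

text \<open>
  Steps of the walk with truncated innovations. Reading off \<open>U\<close> through a sum of indicators keeps the
  recursion well-founded and measurable even off the almost sure event \<open>U n \<in> {1..n}\<close>.
\<close>

function Y :: "nat \<Rightarrow> 'a \<Rightarrow> real" where
  "Y n \<omega> = fresh n \<omega> + (\<Sum>j\<in>{1..<n}. copy (n - 1) j \<omega> * Y j \<omega>)"
  by auto
termination by (relation "Wellfounded.measure fst") auto

declare Y.simps [simp del]

lemma Y_Suc: "Y (Suc n) \<omega> = fresh (Suc n) \<omega> + (\<Sum>j=1..n. copy n j \<omega> * Y j \<omega>)"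
  by (subst Y.simps) (simp add: atLeastLessThanSuc_atLeastAtMost)

section \<open>Boundedness and adaptedness of the truncated steps\<close>

lemma level_nonneg: "level n \<ge> 0" by (simp add: level_def)

lemma abs_copy_le: "\<bar>copy n j \<omega>\<bar> \<le> 1" by (simp add: copy_def)

lemma abs_fresh_le: "\<bar>fresh n \<omega>\<bar> \<le> level n"
  using abs_cutoff_le(1)[of "level n"] level_nonneg[of n] by (simp add: fresh_def \<eta>_def)

lemma Y_bounded: "\<exists>C. \<forall>\<omega>. \<bar>Y n \<omega>\<bar> \<le> C"
proof (induction n rule: less_induct)
  case (less n)
  then obtain C where C: "\<And>j \<omega>. j < n \<Longrightarrow> \<bar>Y j \<omega>\<bar> \<le> C j" by metis
  have "\<bar>Y n \<omega>\<bar> \<le> level n + (\<Sum>j\<in>{1..<n}. 1 * C j)" for \<omega>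
  proof (subst Y.simps, rule order_trans[OF abs_triangle_ineq], rule add_mono[OF abs_fresh_le])
    show "\<bar>\<Sum>j\<in>{1..<n}. copy (n - 1) j \<omega> * Y j \<omega>\<bar> \<le> (\<Sum>j\<in>{1..<n}. 1 * C j)"
      using C abs_copy_le unfolding abs_mult
      by (intro order_trans[OF sum_abs] sum_mono) (auto simp only: abs_mult abs_ge_zero atLeastLessThan_iff intro!: mult_mono)
  qed
  then show ?case by blast
qed

lemma W_F:
  "1 \<le> k \<Longrightarrow> k \<le> n \<Longrightarrow> W (Innovation, k) \<in> borel_measurable (F n)"
  "1 \<le> k \<Longrightarrow> k < n \<Longrightarrow> W (s, k) \<in> borel_measurable (F n)"
  by (rule measurable_generated_algebra, simp add: past_def)+

lemma source_F:
  "1 \<le> k \<Longrightarrow> k \<le> n \<Longrightarrow> \<xi> k \<in> borel_measurable (F n)"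
  "1 \<le> k \<Longrightarrow> k < n \<Longrightarrow> (\<lambda>\<omega>. real (U k \<omega>)) \<in> borel_measurable (F n)"
  "1 \<le> k \<Longrightarrow> k < n \<Longrightarrow> \<gamma> k \<in> borel_measurable (F n)"
  "1 \<le> k \<Longrightarrow> k < n \<Longrightarrow> \<rho> k \<in> borel_measurable (F n)"
  using W_F(1)[of k n] W_F(2)[of k n Uniform_Index] W_F(2)[of k n Memory] W_F(2)[of k n Sign]
  unfolding W_eqs by blast+

lemma copy_F:
  assumes "1 \<le> n" "n < m"
  shows "copy n j \<in> borel_measurable (F m)"
proof -
  note [measurable] = source_F(2-4)[OF assms]
  show ?thesis unfolding copy_def[abs_def] by measurable
qed

lemma fresh_F:
  assumes n: "1 \<le> n" "n \<le> m"
  shows "fresh n \<in> borel_measurable (F m)"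
proof -
  note [measurable] = source_F(1)[OF n]
  have \<eta>: "\<eta> n \<in> borel_measurable (F m)" unfolding \<eta>_def[abs_def] by measurable
  show ?thesis
  proof (cases "n = 1")
    case True
    then show ?thesis using \<eta> by (simp add: fresh_def[abs_def])
  next
    case False
    then have [measurable]: "\<gamma> (n - 1) \<in> borel_measurable (F m)"
      using n by (intro source_F) auto
    note \<eta>[measurable]
    show ?thesis unfolding fresh_def[abs_def] by measurable
  qed
qed

lemma Y_F: "1 \<le> n \<Longrightarrow> n \<le> m \<Longrightarrow> Y n \<in> borel_measurable (F m)"
proof (induction n rule: less_induct)
  case (less n)
  have "(\<lambda>\<omega>. fresh n \<omega> + (\<Sum>j\<in>{1..<n}. copy (n - 1) j \<omega> * Y j \<omega>)) \<in> borel_measurable (F m)"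
    using less by (intro borel_measurable_add borel_measurable_sum borel_measurable_times fresh_F copy_F less.IH) auto
  moreover have "Y n = (\<lambda>\<omega>. fresh n \<omega> + (\<Sum>j\<in>{1..<n}. copy (n - 1) j \<omega> * Y j \<omega>))"
    by (rule ext) (rule Y.simps)
  ultimately show ?case by simp
qed

lemma Y_rv: "1 \<le> n \<Longrightarrow> Y n \<in> borel_measurable M"
  using Y_F[of n n] F_measurable by blast

section \<open>Averaging over the newest sources\<close>

lemma expectation_memory: "n \<ge> 1 \<Longrightarrow> expectation (\<lambda>\<omega>. if \<gamma> n \<omega> = 1 then 1 else 0 :: real) = \<alpha>"
  using expectation_if_eq[OF source_rv(3)] prob_\<gamma>_1 by simp

lemma expectation_no_memory:
  assumes n: "n \<ge> 1"
  shows "expectation (\<lambda>\<omega>. if \<gamma> n \<omega> = 1 then 0 else 1 :: real) = 1 - \<alpha>"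
proof -
  note [measurable] = source_rv[OF n]
  have "expectation (\<lambda>\<omega>. if \<gamma> n \<omega> = 1 then 0 else 1 :: real) = expectation (\<lambda>\<omega>. 1 - (if \<gamma> n \<omega> = 1 then 1 else 0 :: real))"
    by (intro Bochner_Integration.integral_cong) auto
  also have "\<dots> = 1 - expectation (\<lambda>\<omega>. if \<gamma> n \<omega> = 1 then 1 else 0 :: real)"
    by (subst Bochner_Integration.integral_diff) (auto intro!: integrable_bounded[of _ 1] simp: prob_space)
  finally show ?thesis using expectation_memory[OF n] by simp
qed

lemma expectation_sign:
  assumes n: "n \<ge> 1"
  shows "expectation (\<lambda>\<omega>. 2 * (if \<rho> n \<omega> = 1 then 1 else 0) - 1 :: real) = 2 * p - 1"
proof -
  note [measurable] = source_rv[OF n]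
  have int: "integrable M (\<lambda>\<omega>. if \<rho> n \<omega> = 1 then 1 else 0 :: real)"
    by (auto intro!: integrable_bounded[of _ 1])
  have "expectation (\<lambda>\<omega>. 2 * (if \<rho> n \<omega> = 1 then 1 else 0) - 1 :: real)
      = 2 * expectation (\<lambda>\<omega>. if \<rho> n \<omega> = 1 then 1 else 0 :: real) - 1"
    using int by (subst Bochner_Integration.integral_diff) (auto simp: prob_space)
  also have "expectation (\<lambda>\<omega>. if \<rho> n \<omega> = 1 then 1 else 0 :: real) = p"
    using expectation_if_eq[OF source_rv(4)[OF n]] prob_\<rho>_1[OF n] by simp
  finally show ?thesis .
qed

lemma expectation_index:
  assumes n: "n \<ge> 1" and j: "j \<in> {1..n}"
  shows "expectation (\<lambda>\<omega>. if real (U n \<omega>) = real j then 1 else 0 :: real) = 1 / real n"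
proof -
  have U: "U n \<in> measurable M (count_space UNIV)"
    using indep_U n by (simp add: indep_vars_def2)
  have "expectation (\<lambda>\<omega>. if real (U n \<omega>) = real j then 1 else 0 :: real) = prob (U n -` {j} \<inter> space M)"
    using expectation_if_eq[OF source_rv(2)[OF n], of "real j"]
    by (simp add: vimage_def Int_def conj_commute)
  also have "\<dots> = measure (distr M (count_space UNIV) (U n)) {j}"
    using U by (simp add: measure_distr)
  also have "\<dots> = 1 / real n"
    unfolding unif_U[OF n] using j by (simp add: measure_pmf_single)
  finally show ?thesis .
qed

definition a :: real where "a = (2 * p - 1) * \<alpha>"

text \<open>Memory, sign and index of number \<open>n\<close> lie outside \<open>past n\<close>, so
  they split off with means \<open>\<alpha>\<close>, \<open>2 * p - 1\<close> and
  \<open>1 / n\<close>. Squaring removes the sign and leaves \<open>\<alpha> / n\<close>.\<close>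

lemma expectation_mult_copy:
  assumes n: "n \<ge> 1" and j: "j \<in> {1..n}"
    and Z: "Z \<in> borel_measurable (F n)" "integrable M Z"
  shows "expectation (\<lambda>\<omega>. Z \<omega> * copy n j \<omega>) = expectation Z * (a / n)"
    and "integrable M (\<lambda>\<omega>. Z \<omega> * copy n j \<omega>)"
    and "expectation (\<lambda>\<omega>. Z \<omega> * (copy n j \<omega>)\<^sup>2) = expectation Z * (\<alpha> / n)"
    and "integrable M (\<lambda>\<omega>. Z \<omega> * (copy n j \<omega>)\<^sup>2)"
proof -
  note [measurable] = source_rv[OF n]
  let ?f = "\<lambda>x::real. if x = 1 then 1 else 0 :: real"
  let ?g = "\<lambda>x::real. 2 * (if x = 1 then 1 else 0) - 1 :: real"
  let ?h = "\<lambda>x::real. if x = real j then 1 else 0 :: real"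
  have notin: "(Memory, n) \<notin> past n" "(Sign, n) \<notin> past n" "(Uniform_Index, n) \<notin> past n"
    by (auto simp: past_def)
  have S: "(s, n) \<in> UNIV \<times> {1..}" for s :: source using n by simp
  have meas: "?f \<in> borel_measurable borel" "?g \<in> borel_measurable borel" "?h \<in> borel_measurable borel"
    by (intro borel_measurable_diff borel_measurable_times borel_measurable_const borel_measurable_if_eq)+
  have int: "integrable M (\<lambda>\<omega>. ?f (W (Memory, n) \<omega>))" "integrable M (\<lambda>\<omega>. ?g (W (Sign, n) \<omega>))"
    "integrable M (\<lambda>\<omega>. ?h (W (Uniform_Index, n) \<omega>))"
    by (rule integrable_W[OF n, where C = 1], rule meas, simp)+
  note fg = expectation_mult_fresh2[OF indep_W past_subset S notin(1) S notin(2) _ Z meas(1) int(1) meas(2) int(2)]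
  let ?I = "insert (Sign, n) (insert (Memory, n) (past n))"
  have I: "?I \<subseteq> UNIV \<times> {1..}" "(Uniform_Index, n) \<notin> ?I" using past_subset n notin by auto
  note fgh = expectation_mult_fresh[OF indep_W I(1) S I(2)
      measurable_generated_algebra_mult[OF measurable_generated_algebra_mult[OF Z(1) meas(1)] meas(2)]
      fg(2) meas(3) int(3)]
  show "expectation (\<lambda>\<omega>. Z \<omega> * copy n j \<omega>) = expectation Z * (a / n)"
    using fgh(1) fg(1) expectation_memory[OF n] expectation_sign[OF n] expectation_index[OF n j]
    unfolding W_simps copy_def by (simp add: mult.assoc a_def)
  show "integrable M (\<lambda>\<omega>. Z \<omega> * copy n j \<omega>)"
    using fgh(2) unfolding W_simps copy_def by (simp add: mult.assoc)
  have sq: "(copy n j \<omega>)\<^sup>2 = ?f (\<gamma> n \<omega>) * ?h (real (U n \<omega>))" for \<omega>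
    by (simp add: copy_def)
  note fh = expectation_mult_fresh2[OF indep_W past_subset S notin(1) S notin(3) _ Z meas(1) int(1) meas(3) int(3)]
  show "expectation (\<lambda>\<omega>. Z \<omega> * (copy n j \<omega>)\<^sup>2) = expectation Z * (\<alpha> / n)"
    using fh(1) expectation_memory[OF n] expectation_index[OF n j]
    unfolding W_simps sq by (simp add: mult.assoc)
  show "integrable M (\<lambda>\<omega>. Z \<omega> * (copy n j \<omega>)\<^sup>2)"
    using fh(2) unfolding W_simps sq by (simp add: mult.assoc)
qed

text \<open>Because \<open>g 0 = 0\<close>, \<open>g\<close> of the fresh part is the indicator of
  \<open>\<gamma> n \<noteq> 1\<close> times \<open>g\<close> of the truncated innovation, and both
  factors are independent of \<open>F n\<close>. The uses are the identity, for the drift, and the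
  square, for second moments.\<close>

lemma expectation_mult_fresh_innovation:
  fixes g :: "real \<Rightarrow> real"
  assumes n: "n \<ge> 1"
    and Z: "Z \<in> borel_measurable (F n)" "integrable M Z"
    and g: "g \<in> borel_measurable borel" "integrable M (\<lambda>\<omega>. g (\<eta> (Suc n) \<omega>))" "g 0 = 0"
  shows "expectation (\<lambda>\<omega>. Z \<omega> * g (fresh (Suc n) \<omega>)) = expectation Z * ((1 - \<alpha>) * expectation (\<lambda>\<omega>. g (\<eta> (Suc n) \<omega>)))"
    and "integrable M (\<lambda>\<omega>. Z \<omega> * g (fresh (Suc n) \<omega>))"
proof -
  note [measurable] = source_rv[OF n] g(1)
  let ?f = "\<lambda>x::real. if x = 1 then 0 else 1 :: real"
  let ?h = "\<lambda>x::real. g (cutoff (level (Suc n)) x)"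
  have int': "integrable M (\<lambda>\<omega>. ?h (W (Innovation, Suc n) \<omega>))"
    using g(2) by (simp add: W_simps \<eta>_def)
  have notin: "(Memory, n) \<notin> past n" "(Innovation, Suc n) \<notin> past n"
    by (auto simp: past_def)
  have S: "(Memory, n) \<in> UNIV \<times> {1..}" "(Innovation, Suc n) \<in> UNIV \<times> {1..}" using n by simp_all
  have meas: "?f \<in> borel_measurable borel" "?h \<in> borel_measurable borel"
    by (rule borel_measurable_if_eq) measurable
  have int: "integrable M (\<lambda>\<omega>. ?f (W (Memory, n) \<omega>))"
    by (rule integrable_W[OF n, where C = 1], rule meas, simp)
  note fh = expectation_mult_fresh2[OF indep_W past_subset S(1) notin(1) S(2) notin(2) _ Z meas(1) int meas(2) int']
  have eq: "g (fresh (Suc n) \<omega>) = ?f (\<gamma> n \<omega>) * ?h (\<xi> (Suc n) \<omega>)" for \<omega>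
    using n g(3) by (simp add: fresh_def \<eta>_def)
  show "expectation (\<lambda>\<omega>. Z \<omega> * g (fresh (Suc n) \<omega>)) = expectation Z * ((1 - \<alpha>) * expectation (\<lambda>\<omega>. g (\<eta> (Suc n) \<omega>)))"
    using fh(1) expectation_no_memory[OF n]
    unfolding W_simps eq by (simp add: mult.assoc \<eta>_def)
  show "integrable M (\<lambda>\<omega>. Z \<omega> * g (fresh (Suc n) \<omega>))"
    using fh(2) unfolding W_simps eq by (simp add: mult.assoc)
qed

lemma \<alpha>_bounds: "0 \<le> \<alpha>" "\<alpha> \<le> 1"
  using prob_\<gamma>_1[of 1] measure_nonneg[of M "{\<omega> \<in> space M. \<gamma> 1 \<omega> = 1}"]
    prob_le_1[of "{\<omega> \<in> space M. \<gamma> 1 \<omega> = 1}"] by auto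

section \<open>Drift and second moments of the truncated steps\<close>

definition m :: "nat \<Rightarrow> real" where "m n = expectation (\<eta> n)"
definition w :: "nat \<Rightarrow> real" where "w n = expectation (\<lambda>\<omega>. (\<eta> n \<omega>)\<^sup>2)"

lemma \<eta>_rv: "n \<ge> 1 \<Longrightarrow> \<eta> n \<in> borel_measurable M"
  unfolding \<eta>_def[abs_def] using source_rv(1)[of n] by measurable

lemma abs_\<eta>_le: "\<bar>\<eta> n \<omega>\<bar> \<le> level n"
  using abs_cutoff_le(1)[of "level n"] level_nonneg[of n] by (simp add: \<eta>_def)

lemma Y_1: "Y (Suc 0) \<omega> = \<eta> 1 \<omega>"
  by (subst Y_Suc) (simp add: fresh_def)

text \<open>A version of the conditional mean of \<open>Y (Suc n)\<close> given \<open>F n\<close>: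
  each earlier step is copied with mean coefficient \<open>a / n\<close>, and a fresh innovation
  enters with probability \<open>1 - \<alpha>\<close>.\<close>

definition drift :: "nat \<Rightarrow> 'a \<Rightarrow> real" where
  "drift n \<omega> = a / n * (\<Sum>j=1..n. Y j \<omega>) + (1 - \<alpha>) * m (Suc n)"

lemma drift_F: "drift n \<in> borel_measurable (F n)"
  unfolding drift_def[abs_def]
  by (intro borel_measurable_add borel_measurable_times borel_measurable_sum borel_measurable_const)
     (auto intro: Y_F)

lemma drift_rv: "drift n \<in> borel_measurable M"
  using F_measurable[OF drift_F] .

lemma drift_bounded: "\<exists>C. \<forall>\<omega>. \<bar>drift n \<omega>\<bar> \<le> C"
proof -
  obtain C where C: "\<And>j \<omega>. \<bar>Y j \<omega>\<bar> \<le> C j" using Y_bounded by metis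
  have "\<bar>drift n \<omega>\<bar> \<le> \<bar>a / n\<bar> * (\<Sum>j=1..n. C j) + \<bar>(1 - \<alpha>) * m (Suc n)\<bar>" for \<omega>
    unfolding drift_def
    by (rule order_trans[OF abs_triangle_ineq], rule add_right_mono, subst abs_mult,
        intro mult_left_mono order_trans[OF sum_abs] sum_mono C abs_ge_zero)
  then show ?thesis by blast
qed

text \<open>The martingale difference property. After expanding \<open>Y (Suc n)\<close>, the mean
  of each copied term cancels its share of the drift, and the mean of the fresh term cancels the
  remaining constant.\<close>

lemma expectation_mult_innovation:
  assumes n: "n \<ge> 1" and Z: "Z \<in> borel_measurable (F n)" and B: "\<And>\<omega>. \<omega> \<in> space M \<Longrightarrow> \<bar>Z \<omega>\<bar> \<le> B"
  shows "expectation (\<lambda>\<omega>. Z \<omega> * (Y (Suc n) \<omega> - drift n \<omega>)) = 0"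
proof -
  obtain C where C: "\<And>j \<omega>. \<bar>Y j \<omega>\<bar> \<le> C j" using Y_bounded by metis
  have ZM [measurable]: "Z \<in> borel_measurable M" using F_measurable[OF Z] .
  have int_Z: "integrable M Z" using B by (intro integrable_bounded) auto
  have ZY: "(\<lambda>\<omega>. Z \<omega> * Y j \<omega>) \<in> borel_measurable (F n)" "integrable M (\<lambda>\<omega>. Z \<omega> * Y j \<omega>)" if "j \<in> {1..n}" for j
  proof -
    show *: "(\<lambda>\<omega>. Z \<omega> * Y j \<omega>) \<in> borel_measurable (F n)"
      using that by (intro borel_measurable_times Z Y_F) auto
    show "integrable M (\<lambda>\<omega>. Z \<omega> * Y j \<omega>)"
    proof (rule integrable_bounded[OF F_measurable[OF *]])
      show "\<bar>Z \<omega> * Y j \<omega>\<bar> \<le> B * C j" if "\<omega> \<in> space M" for \<omega>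
        using B[OF that] C unfolding abs_mult by (intro mult_mono) (auto intro: order_trans[OF abs_ge_zero])
    qed
  qed
  have int_\<eta>: "integrable M (\<lambda>\<omega>. \<eta> (Suc n) \<omega>)"
    using abs_\<eta>_le by (intro integrable_bounded \<eta>_rv) auto
  note fr = expectation_mult_fresh_innovation[OF n Z int_Z, of "\<lambda>x. x", OF _ int_\<eta>, simplified]
  have "expectation (\<lambda>\<omega>. Z \<omega> * (Y (Suc n) \<omega> - drift n \<omega>)) =
    expectation (\<lambda>\<omega>. Z \<omega> * fresh (Suc n) \<omega> + (\<Sum>j=1..n. Z \<omega> * Y j \<omega> * copy n j \<omega>)
      - (\<Sum>j=1..n. a / n * (Z \<omega> * Y j \<omega>)) - (1 - \<alpha>) * m (Suc n) * Z \<omega>)"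
    by (intro Bochner_Integration.integral_cong)
       (simp_all add: Y_Suc drift_def algebra_simps sum_distrib_left)
  also have "\<dots> = expectation (\<lambda>\<omega>. Z \<omega> * fresh (Suc n) \<omega>)
      + (\<Sum>j=1..n. expectation (\<lambda>\<omega>. Z \<omega> * Y j \<omega> * copy n j \<omega>))
      - (\<Sum>j=1..n. a / n * expectation (\<lambda>\<omega>. Z \<omega> * Y j \<omega>)) - (1 - \<alpha>) * m (Suc n) * expectation Z"
    using fr(2) ZY expectation_mult_copy(2)[OF n _ ZY] int_Z
    by (subst Bochner_Integration.integral_diff Bochner_Integration.integral_add
        Bochner_Integration.integral_sum integral_mult_right_zero; (intro Bochner_Integration.integrable_diff Bochner_Integration.integrable_add
        Bochner_Integration.integrable_sum integrable_mult_right)?; simp?)+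
  also have "\<dots> = 0"
    using expectation_mult_copy(1)[OF n _ ZY] fr(1) by (simp add: m_def algebra_simps)
  finally show ?thesis .
qed

text \<open>No cross terms survive squaring: the fresh part and the copied part are never both
  nonzero, as \<open>\<gamma> n\<close> decides between them, and at most one index \<open>j\<close>
  is copied.\<close>

lemma second_moment_Suc:
  assumes n: "n \<ge> 1"
  shows "expectation (\<lambda>\<omega>. (Y (Suc n) \<omega>)\<^sup>2) = (1 - \<alpha>) * w (Suc n) + \<alpha> / n * (\<Sum>j=1..n. expectation (\<lambda>\<omega>. (Y j \<omega>)\<^sup>2))"
proof -
  obtain C where C: "\<And>j \<omega>. \<bar>Y j \<omega>\<bar> \<le> C j" using Y_bounded by metis
  have Y2: "(\<lambda>\<omega>. (Y j \<omega>)\<^sup>2) \<in> borel_measurable (F n)" "integrable M (\<lambda>\<omega>. (Y j \<omega>)\<^sup>2)" if "j \<in> {1..n}" for j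
    using that C by (auto intro!: borel_measurable_power Y_F integrable_bounded_square[of _ "C j"] Y_rv)
  have int_\<eta>: "integrable M (\<lambda>\<omega>. (\<eta> (Suc n) \<omega>)\<^sup>2)"
    using abs_\<eta>_le by (intro integrable_bounded_square \<eta>_rv) auto
  have one: "(\<lambda>_. 1 :: real) \<in> borel_measurable (F n)" "integrable M (\<lambda>_. 1 :: real)" by simp_all
  have square: "(\<lambda>x::real. x\<^sup>2) \<in> borel_measurable borel" "(0::real)\<^sup>2 = 0" by simp_all
  have fr: "expectation (\<lambda>\<omega>. (fresh (Suc n) \<omega>)\<^sup>2) = (1 - \<alpha>) * w (Suc n)"
    "integrable M (\<lambda>\<omega>. (fresh (Suc n) \<omega>)\<^sup>2)"
    using expectation_mult_fresh_innovation[OF n one square(1) int_\<eta> square(2)]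
    by (simp_all add: w_def prob_space)
  have pointwise: "(Y (Suc n) \<omega>)\<^sup>2 = (fresh (Suc n) \<omega>)\<^sup>2 + (\<Sum>j=1..n. (Y j \<omega>)\<^sup>2 * (copy n j \<omega>)\<^sup>2)" for \<omega>
  proof -
    have disjoint: "fresh (Suc n) \<omega> * (\<Sum>j=1..n. copy n j \<omega> * Y j \<omega>) = 0"
      using n by (auto simp: fresh_def copy_def)
    have "(\<Sum>j=1..n. copy n j \<omega> * Y j \<omega>)\<^sup>2 = (\<Sum>j=1..n. (copy n j \<omega> * Y j \<omega>)\<^sup>2)"
      by (rule square_sum_orthogonal) (auto simp: copy_def)
    then show ?thesis
      using disjoint by (simp add: Y_Suc power2_sum power_mult_distrib mult.commute mult.left_commute)
  qed
  have "expectation (\<lambda>\<omega>. (Y (Suc n) \<omega>)\<^sup>2) =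
      expectation (\<lambda>\<omega>. (fresh (Suc n) \<omega>)\<^sup>2) + (\<Sum>j=1..n. expectation (\<lambda>\<omega>. (Y j \<omega>)\<^sup>2 * (copy n j \<omega>)\<^sup>2))"
    unfolding pointwise using fr(2) expectation_mult_copy(4)[OF n _ Y2]
    by (subst Bochner_Integration.integral_add) (auto intro!: Bochner_Integration.integrable_sum)
  also have "\<dots> = (1 - \<alpha>) * w (Suc n) + (\<Sum>j=1..n. expectation (\<lambda>\<omega>. (Y j \<omega>)\<^sup>2) * (\<alpha> / n))"
    using fr(1) expectation_mult_copy(3)[OF n _ Y2] by simp
  finally show ?thesis by (simp add: sum_distrib_left mult.commute)
qed

lemma expectation_\<xi>:
  fixes f :: "real \<Rightarrow> real"
  assumes n: "n \<ge> 1" and f: "f \<in> borel_measurable borel"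
  shows "expectation (\<lambda>\<omega>. f (\<xi> n \<omega>)) = expectation (\<lambda>\<omega>. f (\<xi> 1 \<omega>))"
  using integral_distr[OF source_rv(1)[OF n] f] integral_distr[OF source_rv(1)[of 1] f] ident_\<xi>[OF n]
  by simp

lemma w_eq: "n \<ge> 1 \<Longrightarrow> w n = expectation (\<lambda>\<omega>. (cutoff (level n) (\<xi> 1 \<omega>))\<^sup>2)"
  unfolding w_def \<eta>_def by (rule expectation_\<xi>) auto

lemma m_eq: "n \<ge> 1 \<Longrightarrow> m n = expectation (\<lambda>\<omega>. cutoff (level n) (\<xi> 1 \<omega>))"
  unfolding m_def \<eta>_def[abs_def] by (rule expectation_\<xi>) auto

lemma integrable_cutoff_square: "integrable M (\<lambda>\<omega>. (cutoff L (\<xi> 1 \<omega>))\<^sup>2)"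
  using abs_cutoff_le(1) source_rv(1)[of 1]
  by (intro integrable_bounded_square[of _ "\<bar>L\<bar>"]) auto

lemma w_mono:
  assumes "1 \<le> n" "n \<le> n'"
  shows "w n \<le> w n'"
proof -
  have "level n \<le> level n'" using assms by (simp add: level_def)
  then show ?thesis
    using assms unfolding w_eq[OF assms(1)] w_eq[OF order_trans[OF assms]]
    by (intro integral_mono integrable_cutoff_square cutoff_square_mono)
qed

text \<open>The recursion is a convex combination of \<open>w (Suc n)\<close> and the average of
  earlier second moments. By induction and monotonicity of \<open>w\<close> these are all at most
  \<open>w (Suc n)\<close>.\<close>

lemma second_moment_le: "n \<ge> 1 \<Longrightarrow> expectation (\<lambda>\<omega>. (Y n \<omega>)\<^sup>2) \<le> w n"
proof (induction n rule: less_induct)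
  case (less n)
  show ?case
  proof (cases "n = 1")
    case True
    then show ?thesis by (simp add: Y_1 w_def)
  next
    case False
    then obtain k where k: "n = Suc k" "k \<ge> 1" using less.prems by (cases n) auto
    have "(\<Sum>j=1..k. expectation (\<lambda>\<omega>. (Y j \<omega>)\<^sup>2)) \<le> (\<Sum>j=1..k. w n)"
    proof (rule sum_mono)
      fix j assume "j \<in> {1..k}"
      then show "expectation (\<lambda>\<omega>. (Y j \<omega>)\<^sup>2) \<le> w n"
        using less.IH[of j] w_mono[of j n] k by force
    qed
    then have "\<alpha> / k * (\<Sum>j=1..k. expectation (\<lambda>\<omega>. (Y j \<omega>)\<^sup>2)) \<le> \<alpha> / k * (k * w n)"
      using \<alpha>_bounds by (intro mult_left_mono) auto
    then show ?thesis
      using second_moment_Suc[OF k(2)] k by (simp add: algebra_simps)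
  qed
qed

text \<open>Truncating at \<open>max n K\<close> costs at most the square truncated at
  \<open>n\<close> plus \<open>K^2\<close>. Divided by \<open>n^2\<close>, the first part sums to at
  most twice the mean of \<open>\<bar>\<xi> 1 \<omega>\<bar>\<close>, as in Kolmogorov's strong law,
  and the second is a multiple of a convergent series.\<close>

lemma summable_w: "summable (\<lambda>n. w (Suc n) / (real (Suc n))\<^sup>2)"
proof -
  note [measurable] = source_rv(1)[OF order_refl[of "1::nat"]]
  define q where "q k = expectation (\<lambda>\<omega>. if \<bar>\<xi> 1 \<omega>\<bar> \<le> real k then \<bar>\<xi> 1 \<omega>\<bar>\<^sup>2 / (real k)\<^sup>2 else 0)" for k
  have int: "integrable M (\<lambda>\<omega>. if \<bar>\<xi> 1 \<omega>\<bar> \<le> real k then \<bar>\<xi> 1 \<omega>\<bar>\<^sup>2 / (real k)\<^sup>2 else 0)" for k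
  proof (rule integrable_bounded)
    show "\<bar>if \<bar>\<xi> 1 \<omega>\<bar> \<le> real k then \<bar>\<xi> 1 \<omega>\<bar>\<^sup>2 / (real k)\<^sup>2 else 0\<bar> \<le> 1" for \<omega>
      by (auto simp: divide_le_eq_1 abs_le_square_iff[symmetric])
  qed measurable
  have "summable (\<lambda>n. q (Suc n))"
  proof (rule summableI_nonneg_bounded)
    show "0 \<le> q (Suc n)" for n unfolding q_def by (intro Bochner_Integration.integral_nonneg) auto
    show "(\<Sum>i<n. q (Suc i)) \<le> expectation (\<lambda>\<omega>. 2 * \<bar>\<xi> 1 \<omega>\<bar>)" for n
    proof -
      have "(\<Sum>i<n. q (Suc i)) = (\<Sum>k=1..n. q k)"
        by (rule sum.reindex_bij_witness[of _ "\<lambda>k. k - 1" Suc]) auto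
      also have "\<dots> = expectation (\<lambda>\<omega>. \<Sum>k=1..n. if \<bar>\<xi> 1 \<omega>\<bar> \<le> real k then \<bar>\<xi> 1 \<omega>\<bar>\<^sup>2 / (real k)\<^sup>2 else 0)"
        unfolding q_def by (intro Bochner_Integration.integral_sum[symmetric] int)
      also have "\<dots> \<le> expectation (\<lambda>\<omega>. 2 * \<bar>\<xi> 1 \<omega>\<bar>)"
      proof (rule integral_mono)
        fix \<omega>
        show "(\<Sum>k=1..n. if \<bar>\<xi> 1 \<omega>\<bar> \<le> real k then \<bar>\<xi> 1 \<omega>\<bar>\<^sup>2 / (real k)\<^sup>2 else 0) \<le> 2 * \<bar>\<xi> 1 \<omega>\<bar>"
          by (rule sum_truncated_square_le) simp
      qed (use int integrable_\<xi> in \<open>auto intro!: Bochner_Integration.integrable_sum\<close>)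
      finally show ?thesis .
    qed
  qed
  moreover have "summable (\<lambda>n. (real K)\<^sup>2 * inverse (real (Suc n) ^ 2))"
    using summable_Suc_iff[of "\<lambda>n. inverse (real n ^ 2)"] inverse_power_summable[of 2, where 'a = real]
    by (intro summable_mult) (simp del: of_nat_Suc)
  ultimately have "summable (\<lambda>n. q (Suc n) + (real K)\<^sup>2 * inverse (real (Suc n) ^ 2))"
    by (rule summable_add)
  then show ?thesis
  proof (rule summable_comparison_test'[where N = 0])
    fix n
    have "w (Suc n) / (real (Suc n))\<^sup>2 = expectation (\<lambda>\<omega>. (cutoff (level (Suc n)) (\<xi> 1 \<omega>))\<^sup>2 / (real (Suc n))\<^sup>2)"
      by (simp add: w_eq)
    also have "\<dots> \<le> expectation (\<lambda>\<omega>. (if \<bar>\<xi> 1 \<omega>\<bar> \<le> real (Suc n) then \<bar>\<xi> 1 \<omega>\<bar>\<^sup>2 / (real (Suc n))\<^sup>2 else 0) + (real K)\<^sup>2 / (real (Suc n))\<^sup>2)"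
    proof (rule integral_mono)
      fix \<omega>
      show "(cutoff (level (Suc n)) (\<xi> 1 \<omega>))\<^sup>2 / (real (Suc n))\<^sup>2
        \<le> (if \<bar>\<xi> 1 \<omega>\<bar> \<le> real (Suc n) then \<bar>\<xi> 1 \<omega>\<bar>\<^sup>2 / (real (Suc n))\<^sup>2 else 0) + (real K)\<^sup>2 / (real (Suc n))\<^sup>2"
        by (auto simp: cutoff_def level_def abs_le_square_iff[symmetric] intro!: divide_right_mono)
    qed (use integrable_cutoff_square int[of "Suc n"] in auto)
    also have "\<dots> = q (Suc n) + (real K)\<^sup>2 * inverse (real (Suc n) ^ 2)"
      using int[of "Suc n"]
      by (subst Bochner_Integration.integral_add) (auto simp: q_def prob_space divide_inverse)
    finally show "norm (w (Suc n) / (real (Suc n))\<^sup>2) \<le> q (Suc n) + (real K)\<^sup>2 * inverse (real (Suc n) ^ 2)"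
      by (simp add: w_def)
  qed
qed

lemma m_tendsto: "m \<longlonglongrightarrow> expectation (\<xi> 1)"
proof -
  note [measurable] = source_rv(1)[OF order_refl[of "1::nat"]]
  have "(\<lambda>n. expectation (\<lambda>\<omega>. cutoff (level n) (\<xi> 1 \<omega>))) \<longlonglongrightarrow> expectation (\<xi> 1)"
  proof (rule integral_dominated_convergence[where w = "\<lambda>\<omega>. \<bar>\<xi> 1 \<omega>\<bar>"])
    show "AE \<omega> in M. (\<lambda>n. cutoff (level n) (\<xi> 1 \<omega>)) \<longlonglongrightarrow> \<xi> 1 \<omega>"
    proof (rule AE_I2, rule tendsto_eventually)
      fix \<omega>
      show "eventually (\<lambda>n. cutoff (level n) (\<xi> 1 \<omega>) = \<xi> 1 \<omega>) sequentially"
        using eventually_ge_at_top[of "nat \<lceil>\<bar>\<xi> 1 \<omega>\<bar>\<rceil>"]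
        by eventually_elim (auto simp: cutoff_def level_def)
    qed
    show "AE \<omega> in M. norm (cutoff (level n) (\<xi> 1 \<omega>)) \<le> \<bar>\<xi> 1 \<omega>\<bar>" for n
      using abs_cutoff_le(2) by auto
  qed (use integrable_\<xi> in auto)
  \<comment> \<open>\<open>m 0\<close> involves \<open>\<xi> 0\<close>, whose law is unspecified, so
    the two sequences are compared from index 1 on.\<close>
  then show ?thesis
    by (rule Lim_transform_eventually) (rule eventually_mono[OF eventually_ge_at_top[of 1] m_eq[symmetric]])
qed

section \<open>Martingale noise and convergence of the truncated averages\<close>

text \<open>The noise in the recursion for the averages, hence the divisor \<open>Suc n\<close>. At
  \<open>n = 0\<close> it is set to 0, since \<open>Y 1 - drift 0\<close> need not be
  centred.\<close>

definition D :: "nat \<Rightarrow> 'a \<Rightarrow> real" where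
  "D n \<omega> = (if n = 0 then 0 else (Y (Suc n) \<omega> - drift n \<omega>) / real (Suc n))"

lemma AE_summable_D: "AE \<omega> in M. summable (\<lambda>n. D n \<omega>)"
proof -
  interpret bounded_martingale_differences M F D
  proof unfold_locales
    show "subalgebra M (F n)" for n by (rule subalgebra_F)
    show "sets (F i) \<subseteq> sets (F n)" if "i \<le> n" for i n
      by (rule generated_algebra_mono[OF past_mono[OF that]])
    show "D n \<in> borel_measurable (F (Suc n))" for n
    proof -
      have "drift n \<in> borel_measurable (F (Suc n))"
        by (rule measurable_from_subalg[OF _ drift_F])
           (simp add: subalgebra_def generated_algebra_mono past_mono)
      then show ?thesis
        unfolding D_def[abs_def] using Y_F[of "Suc n" "Suc n"] by (cases "n = 0") auto
    qed
    show "\<exists>C. \<forall>\<omega>\<in>space M. \<bar>D n \<omega>\<bar> \<le> C" for n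
    proof -
      obtain B C where "\<And>\<omega>. \<bar>Y (Suc n) \<omega>\<bar> \<le> B" "\<And>\<omega>. \<bar>drift n \<omega>\<bar> \<le> C"
        using Y_bounded drift_bounded by metis
      then have *: "\<bar>Y (Suc n) \<omega> - drift n \<omega>\<bar> \<le> B + C" for \<omega>
        by (rule order_trans[OF abs_triangle_ineq4 add_mono])
      have "\<bar>D n \<omega>\<bar> \<le> (B + C) / real (Suc n)" for \<omega>
        using *[of \<omega>] order_trans[OF abs_ge_zero *[of \<omega>]]
        by (auto simp: D_def abs_divide intro!: divide_right_mono)
      then show ?thesis by blast
    qed
    show "expectation (\<lambda>\<omega>. Z \<omega> * D n \<omega>) = 0"
      if Z: "Z \<in> borel_measurable (F n)" "\<exists>C. \<forall>\<omega>\<in>space M. \<bar>Z \<omega>\<bar> \<le> C" for n Z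
    proof (cases "n = 0")
      case False
      then show ?thesis
        using expectation_mult_innovation[of n Z] Z by (auto simp: D_def)
    qed (simp add: D_def)
  qed
  show ?thesis
  proof (rule AE_summable, rule summable_comparison_test'[OF summable_w, where N = 1])
    fix n :: nat assume n: "n \<ge> 1"
    obtain B C where B: "\<And>\<omega>. \<bar>Y (Suc n) \<omega>\<bar> \<le> B" and C: "\<And>\<omega>. \<bar>drift n \<omega>\<bar> \<le> C"
      using Y_bounded drift_bounded by metis
    have *: "\<bar>Y (Suc n) \<omega> - drift n \<omega>\<bar> \<le> B + C" for \<omega>
      using B C by (rule order_trans[OF abs_triangle_ineq4 add_mono])
    note [measurable] = Y_rv[of "Suc n", simplified] drift_rv[of n]
    have int: "integrable M (\<lambda>\<omega>. (Y (Suc n) \<omega> - drift n \<omega>)\<^sup>2)" "integrable M (\<lambda>\<omega>. (drift n \<omega>)\<^sup>2)"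
      using * C by (auto intro!: integrable_bounded_square)
    have "\<bar>drift n \<omega> * (Y (Suc n) \<omega> - drift n \<omega>)\<bar> \<le> C * (B + C)" for \<omega>
      unfolding abs_mult using * C by (intro mult_mono) (auto intro: order_trans[OF abs_ge_zero])
    then have int_cross: "integrable M (\<lambda>\<omega>. drift n \<omega> * (Y (Suc n) \<omega> - drift n \<omega>))"
      by (intro integrable_bounded) auto
    \<comment> \<open>Pythagoras: the drift is bounded and \<open>F n\<close>-measurable, hence
      orthogonal to the centred step, so centring can only lower the second moment.\<close>
    have "expectation (\<lambda>\<omega>. (Y (Suc n) \<omega>)\<^sup>2) = expectation (\<lambda>\<omega>. (Y (Suc n) \<omega> - drift n \<omega>)\<^sup>2
        + 2 * (drift n \<omega> * (Y (Suc n) \<omega> - drift n \<omega>)) + (drift n \<omega>)\<^sup>2)"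
      by (intro Bochner_Integration.integral_cong) (auto simp: power2_eq_square algebra_simps)
    also have "\<dots> = expectation (\<lambda>\<omega>. (Y (Suc n) \<omega> - drift n \<omega>)\<^sup>2) + expectation (\<lambda>\<omega>. (drift n \<omega>)\<^sup>2)"
      using int int_cross expectation_mult_innovation[OF n drift_F C] by simp
    finally have "expectation (\<lambda>\<omega>. (Y (Suc n) \<omega> - drift n \<omega>)\<^sup>2) \<le> expectation (\<lambda>\<omega>. (Y (Suc n) \<omega>)\<^sup>2)"
      by simp
    also have "\<dots> \<le> w (Suc n)" by (rule second_moment_le) simp
    finally have "expectation (\<lambda>\<omega>. (Y (Suc n) \<omega> - drift n \<omega>)\<^sup>2) / (real (Suc n))\<^sup>2 \<le> w (Suc n) / (real (Suc n))\<^sup>2"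
      by (rule divide_right_mono) simp
    moreover have "expectation (\<lambda>\<omega>. (D n \<omega>)\<^sup>2) = expectation (\<lambda>\<omega>. (Y (Suc n) \<omega> - drift n \<omega>)\<^sup>2) / (real (Suc n))\<^sup>2"
      using n by (simp add: D_def power_divide del: of_nat_Suc)
    ultimately show "norm (expectation (\<lambda>\<omega>. (D n \<omega>)\<^sup>2)) \<le> w (Suc n) / (real (Suc n))\<^sup>2"
      by simp
  qed
qed

text \<open>On a path with summable noise, writing \<open>Y (Suc n)\<close> as
  \<open>drift n\<close> plus \<open>Suc n\<close> times \<open>D n\<close> gives the averaged
  recursion with \<open>c = 1 - a\<close> and inputs \<open>(1 - \<alpha>) * m n\<close>.\<close>

lemma AE_truncated_average:
  assumes "a < 1"
  shows "AE \<omega> in M. (\<lambda>n. walk Y n \<omega> / real n) \<longlonglongrightarrow> (1 - \<alpha>) * expectation (\<xi> 1) / (1 - a)"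
  using AE_summable_D
proof (rule AE_mp, intro AE_I2 impI)
  fix \<omega> assume sum: "summable (\<lambda>n. D n \<omega>)"
  show "(\<lambda>n. walk Y n \<omega> / real n) \<longlonglongrightarrow> (1 - \<alpha>) * expectation (\<xi> 1) / (1 - a)"
  proof (rule averaged_recursion_tendsto[where b = "\<lambda>n. (1 - \<alpha>) * m n" and d = "\<lambda>n. D n \<omega>"])
    show "0 < 1 - a" using assms by simp
    show "(\<lambda>n. (1 - \<alpha>) * m n) \<longlonglongrightarrow> (1 - \<alpha>) * expectation (\<xi> 1)"
      by (intro tendsto_intros m_tendsto)
    show "summable (\<lambda>n. D n \<omega>)" by (rule sum)
    show "walk Y (Suc n) \<omega> / real (Suc n) = walk Y n \<omega> / real n * (1 - (1 - a) / real (Suc n))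
        + (1 - \<alpha>) * m (Suc n) / real (Suc n) + D n \<omega>" if n: "n \<ge> 1" for n
    proof -
      define t u where "t = walk Y n \<omega>" and "u = real n"
      have u: "u > 0" "real (Suc n) = u + 1" using n by (auto simp: u_def)
      have D: "D n \<omega> = (Y (Suc n) \<omega> - (a / u * t + (1 - \<alpha>) * m (Suc n))) / (u + 1)"
        using n u by (simp add: D_def drift_def t_def walk_def u_def)
      have T: "walk Y (Suc n) \<omega> = t + Y (Suc n) \<omega>" by (simp add: t_def walk_def)
      show ?thesis
        unfolding T D u(2) unfolding t_def[symmetric] u_def[symmetric]
        using u(1) by (simp add: divide_simps) (simp add: algebra_simps)
    qed
  qed
qed

section \<open>Removal of the truncation\<close>

text \<open>Outside countably many null sets all indices, memory bits, signs and step identities are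
  as intended. If moreover no innovation exceeds its level, both walks obey the same recursion from
  the same start, and induction identifies them.\<close>

lemma AE_truncation_exact:
  "AE \<omega> in M. (\<forall>n\<ge>1. \<bar>\<xi> n \<omega>\<bar> \<le> level n) \<longrightarrow> (\<forall>n\<ge>1. X n \<omega> = Y n \<omega>)"
proof -
  have "AE \<omega> in M. n \<ge> 1 \<longrightarrow> U n \<omega> \<in> {1..n}" for n
  proof (cases "n \<ge> 1")
    case True
    have "U n \<in> measurable M (count_space UNIV)"
      using indep_U True by (simp add: indep_vars_def2)
    moreover have "AE k in distr M (count_space UNIV) (U n). k \<in> {1..n}"
      unfolding unif_U[OF True] using True by (auto simp: AE_measure_pmf_iff set_pmf_of_set)
    ultimately show ?thesis by (subst (asm) AE_distr_iff) auto
  qed simp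
  moreover have "AE \<omega> in M. n \<ge> 1 \<longrightarrow> \<gamma> n \<omega> = 1 \<or> \<gamma> n \<omega> = 0" for n
  proof (cases "n \<ge> 1")
    case True
    note [measurable] = source_rv(3)[OF True]
    have "prob ({\<omega> \<in> space M. \<gamma> n \<omega> = 1} \<union> {\<omega> \<in> space M. \<gamma> n \<omega> = 0}) = 1"
      using prob_\<gamma>_1[OF True] prob_\<gamma>_0[OF True] by (subst finite_measure_Union) auto
    then have "AE \<omega> in M. \<omega> \<in> {\<omega> \<in> space M. \<gamma> n \<omega> = 1} \<union> {\<omega> \<in> space M. \<gamma> n \<omega> = 0}"
      by (subst (asm) prob_eq_1) auto
    then show ?thesis by (rule AE_mp) auto
  qed simp
  moreover have "AE \<omega> in M. n \<ge> 1 \<longrightarrow> \<rho> n \<omega> = 1 \<or> \<rho> n \<omega> = - 1" for n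
  proof (cases "n \<ge> 1")
    case True
    note [measurable] = source_rv(4)[OF True]
    have "prob ({\<omega> \<in> space M. \<rho> n \<omega> = 1} \<union> {\<omega> \<in> space M. \<rho> n \<omega> = - 1}) = 1"
      using prob_\<rho>_1[OF True] prob_\<rho>_minus_1[OF True] by (subst finite_measure_Union) auto
    then have "AE \<omega> in M. \<omega> \<in> {\<omega> \<in> space M. \<rho> n \<omega> = 1} \<union> {\<omega> \<in> space M. \<rho> n \<omega> = - 1}"
      by (subst (asm) prob_eq_1) auto
    then show ?thesis by (rule AE_mp) auto
  qed simp
  moreover have "AE \<omega> in M. n \<ge> 1 \<longrightarrow>
      X (n + 1) \<omega> = \<gamma> n \<omega> * \<rho> n \<omega> * X (U n \<omega>) \<omega> + (1 - \<gamma> n \<omega>) * \<xi> (n + 1) \<omega>" for n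
    using X_Suc[of n] by (cases "n \<ge> 1") auto
  ultimately have "AE \<omega> in M. \<forall>n. (n \<ge> 1 \<longrightarrow> U n \<omega> \<in> {1..n}) \<and> (n \<ge> 1 \<longrightarrow> \<gamma> n \<omega> = 1 \<or> \<gamma> n \<omega> = 0)
      \<and> (n \<ge> 1 \<longrightarrow> \<rho> n \<omega> = 1 \<or> \<rho> n \<omega> = - 1) \<and> (n \<ge> 1 \<longrightarrow>
      X (n + 1) \<omega> = \<gamma> n \<omega> * \<rho> n \<omega> * X (U n \<omega>) \<omega> + (1 - \<gamma> n \<omega>) * \<xi> (n + 1) \<omega>)"
    unfolding AE_all_countable by simp
  with X_1 show ?thesis
  proof eventually_elim
    case (elim \<omega>)
    have step: "U k \<omega> \<in> {1..k}" "\<gamma> k \<omega> = 1 \<or> \<gamma> k \<omega> = 0" "\<rho> k \<omega> = 1 \<or> \<rho> k \<omega> = - 1"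
      "X (Suc k) \<omega> = \<gamma> k \<omega> * \<rho> k \<omega> * X (U k \<omega>) \<omega> + (1 - \<gamma> k \<omega>) * \<xi> (Suc k) \<omega>" if "k \<ge> 1" for k
      using elim(2)[rule_format, of k] that by auto
    show ?case
    proof (intro impI allI)
      fix n :: nat
      assume small: "\<forall>n\<ge>1. \<bar>\<xi> n \<omega>\<bar> \<le> level n" and "n \<ge> 1"
      have \<eta>: "\<eta> k \<omega> = \<xi> k \<omega>" if "k \<ge> 1" for k
        using small that by (simp add: \<eta>_def cutoff_def)
      show "X n \<omega> = Y n \<omega>"
        using \<open>n \<ge> 1\<close>
      proof (induction n rule: less_induct)
        case (less n)
        show ?case
        proof (cases "n = 1")
          case True
          then show ?thesis using elim(1) \<eta>[of 1] by (simp add: Y_1)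
        next
          case False
          then obtain k where k: "n = Suc k" "k \<ge> 1" using less.prems by (cases n) auto
          \<comment> \<open>The indicators select \<open>j = U k \<omega>\<close>, which lies in the
            range of the sum; with \<open>\<gamma>\<close> in \<open>{0, 1}\<close> and
            \<open>\<rho>\<close> in \<open>{1, -1}\<close> the remaining coefficient is their
            product.\<close>
          have "(\<Sum>j=1..k. copy k j \<omega> * Y j \<omega>) = (\<Sum>j=1..k. if j = U k \<omega> then \<gamma> k \<omega> * \<rho> k \<omega> * Y j \<omega> else 0)"
            using step(2,3)[OF k(2)] by (intro sum.cong) (auto simp: copy_def)
          also have "\<dots> = \<gamma> k \<omega> * \<rho> k \<omega> * Y (U k \<omega>) \<omega>"
            using step(1)[OF k(2)] by (subst sum.delta) auto
          also have "Y (U k \<omega>) \<omega> = X (U k \<omega>) \<omega>"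
            using step(1)[OF k(2)] k by (intro less.IH[symmetric]) auto
          finally have "Y n \<omega> = fresh (Suc k) \<omega> + \<gamma> k \<omega> * \<rho> k \<omega> * X (U k \<omega>) \<omega>"
            by (simp add: k Y_Suc)
          moreover have "fresh (Suc k) \<omega> = (1 - \<gamma> k \<omega>) * \<xi> (Suc k) \<omega>"
            using step(2)[OF k(2)] k \<eta>[of "Suc k"] by (auto simp: fresh_def)
          ultimately show ?thesis using step(4)[OF k(2)] k by simp
        qed
      qed
    qed
  qed
qed

lemma AE_average_if_no_truncation:
  assumes "a < 1"
  shows "AE \<omega> in M. (\<forall>n\<ge>1. \<bar>\<xi> n \<omega>\<bar> \<le> real (max n K)) \<longrightarrow>
    (\<lambda>n. walk X n \<omega> / real n) \<longlonglongrightarrow> (1 - \<alpha>) * expectation (\<xi> 1) / (1 - (2 * p - 1) * \<alpha>)"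
  using AE_truncated_average[OF assms] AE_truncation_exact
proof eventually_elim
  case (elim \<omega>)
  show ?case
  proof
    assume "\<forall>n\<ge>1. \<bar>\<xi> n \<omega>\<bar> \<le> real (max n K)"
    then have "\<forall>n\<ge>1. X n \<omega> = Y n \<omega>" using elim(2) unfolding level_def by blast
    then have "walk X n \<omega> = walk Y n \<omega>" for n by (simp add: walk_def)
    then show "(\<lambda>n. walk X n \<omega> / real n) \<longlonglongrightarrow> (1 - \<alpha>) * expectation (\<xi> 1) / (1 - (2 * p - 1) * \<alpha>)"
      using elim(1) unfolding a_def by simp
  qed
qed

text \<open>The probabilities of \<open>\<bar>\<xi> n \<omega>\<bar> > n\<close> sum to at most the
  mean of \<open>\<bar>\<xi> 1 \<omega>\<bar>\<close>, so by Borel-Cantelli only finitely many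
  exceedances occur, and a large \<open>K\<close> dominates those.\<close>

lemma AE_eventually_untruncated: "AE \<omega> in M. \<exists>K::nat. \<forall>n\<ge>1. \<bar>\<xi> n \<omega>\<bar> \<le> real (max n K)"
proof -
  define A where "A n = {\<omega>\<in>space M. \<bar>\<xi> (Suc n) \<omega>\<bar> > real (Suc n)}" for n
  have \<xi>_rv [measurable]: "\<xi> (Suc n) \<in> borel_measurable M" for n
    by (rule source_rv) simp
  have A [measurable]: "A n \<in> events" for n unfolding A_def by measurable
  let ?e = "\<lambda>k \<omega>. if \<bar>\<xi> 1 \<omega>\<bar> > real k then 1 else 0 :: real"
  have [measurable]: "\<xi> (Suc 0) \<in> borel_measurable M" by (rule \<xi>_rv)
  have int: "integrable M (?e k)" for k by (rule integrable_bounded[of _ 1]) auto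
  have prob_A: "prob (A n) = expectation (?e (Suc n))" for n
  proof -
    have "prob (A n) = expectation (indicator (A n))" using A by simp
    also have "\<dots> = expectation (\<lambda>\<omega>. (\<lambda>x. if \<bar>x\<bar> > real (Suc n) then 1 else 0 :: real) (\<xi> (Suc n) \<omega>))"
      by (intro Bochner_Integration.integral_cong) (auto simp: A_def indicator_def)
    also have "\<dots> = expectation (\<lambda>\<omega>. (\<lambda>x. if \<bar>x\<bar> > real (Suc n) then 1 else 0 :: real) (\<xi> 1 \<omega>))"
      by (rule expectation_\<xi>) auto
    finally show ?thesis by simp
  qed
  have "summable (\<lambda>n. prob (A n))"
  proof (rule summableI_nonneg_bounded)
    show "(\<Sum>i<n. prob (A i)) \<le> expectation (\<lambda>\<omega>. \<bar>\<xi> 1 \<omega>\<bar>)" for n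
    proof -
      have "(\<Sum>i<n. prob (A i)) = (\<Sum>k=1..n. expectation (?e k))"
        unfolding prob_A by (rule sum.reindex_bij_witness[of _ "\<lambda>k. k - 1" Suc]) auto
      also have "\<dots> = expectation (\<lambda>\<omega>. \<Sum>k=1..n. ?e k \<omega>)"
        by (intro Bochner_Integration.integral_sum[symmetric] int)
      also have "\<dots> \<le> expectation (\<lambda>\<omega>. \<bar>\<xi> 1 \<omega>\<bar>)"
        using integrable_\<xi> int sum_exceedances_le[of "\<bar>\<xi> 1 _\<bar>" n]
        by (intro integral_mono Bochner_Integration.integrable_sum) auto
      finally show ?thesis .
    qed
  qed simp
  then have "AE \<omega> in M. eventually (\<lambda>n. \<omega> \<in> space M - A n) sequentially"
    by (intro borel_cantelli_AE1) (auto simp: less_top[symmetric])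
  then show ?thesis
  proof (rule AE_mp, intro AE_I2 impI)
    fix \<omega> assume "\<omega> \<in> space M" "eventually (\<lambda>n. \<omega> \<in> space M - A n) sequentially"
    then obtain N where N: "\<And>n. n \<ge> N \<Longrightarrow> \<bar>\<xi> (Suc n) \<omega>\<bar> \<le> real (Suc n)"
      by (auto simp: eventually_sequentially A_def not_less)
    \<comment> \<open>The sum dominates each of its terms, so \<open>L\<close> handles all
      \<open>n \<le> N\<close>. For \<open>n > N\<close> the bound at \<open>n - 1\<close> applies,
      as \<open>A n\<close> speaks of \<open>\<xi> (Suc n)\<close>.\<close>
    define L where "L = nat \<lceil>\<Sum>n\<le>N. \<bar>\<xi> n \<omega>\<bar>\<rceil>"
    have "\<bar>\<xi> n \<omega>\<bar> \<le> real (max n L)" if "n \<ge> 1" for n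
    proof (cases "n \<le> N")
      case True
      have "\<bar>\<xi> n \<omega>\<bar> \<le> (\<Sum>n\<le>N. \<bar>\<xi> n \<omega>\<bar>)" using True by (intro member_le_sum) auto
      also have "\<dots> \<le> real L" unfolding L_def by linarith
      finally show ?thesis by simp
    next
      case False
      then have "\<bar>\<xi> n \<omega>\<bar> \<le> real n" using N[of "n - 1"] that by simp
      also have "\<dots> \<le> real (max n L)" by simp
      finally show ?thesis .
    qed
    then show "\<exists>K::nat. \<forall>n\<ge>1. \<bar>\<xi> n \<omega>\<bar> \<le> real (max n K)" by blast
  qed
qed

end

theorem theorem1:
  fixes M :: "'a measure"
    and \<xi> :: "nat \<Rightarrow> 'a \<Rightarrow> real"
    and U :: "nat \<Rightarrow> 'a \<Rightarrow> nat"
    and \<gamma> \<rho> X :: "nat \<Rightarrow> 'a \<Rightarrow> real"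
    and p \<alpha> a \<mu>\<^sub>1 :: real
  assumes "unbalanced_srrw M \<xi> U \<gamma> \<rho> X p \<alpha>"
    and "0 \<le> p" "p \<le> 1"
    and "0 < \<alpha>" "\<alpha> \<le> 1"
    and "a = (2 * p - 1) * \<alpha>"
    and "- 1 \<le> a" "a < 1"
    and "integrable M (\<xi> 1)"
    and "\<mu>\<^sub>1 = integral\<^sup>L M (\<xi> 1)"
  shows "AE \<omega> in M. (\<lambda>n. walk X n \<omega> / real n) \<longlonglongrightarrow> (1 - \<alpha>) * \<mu>\<^sub>1 / (1 - a)"
proof -
  \<comment> \<open>The locale predicate has no argument \<open>K\<close>, so each fact of the
    locale is available for every \<open>K\<close>.\<close>
  have T: "truncated_srrw M \<xi> U \<gamma> \<rho> X p \<alpha>"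
    using assms(1,9) by (simp add: truncated_srrw_def truncated_srrw_axioms_def)
  have "truncated_srrw.a p \<alpha> < 1"
    using assms(6,8) by (simp add: truncated_srrw.a_def[OF T])
  \<comment> \<open>The suitable \<open>K\<close> depends on \<open>\<omega>\<close>. The limit is
    the same for all \<open>K\<close>, and there are countably many of them, so one null set serves
    all and \<open>K\<close> may be chosen afterwards.\<close>
  then have "AE \<omega> in M. \<forall>K::nat. (\<forall>n\<ge>1. \<bar>\<xi> n \<omega>\<bar> \<le> real (max n K)) \<longrightarrow>
      (\<lambda>n. walk X n \<omega> / real n) \<longlonglongrightarrow> (1 - \<alpha>) * \<mu>\<^sub>1 / (1 - a)"
    unfolding AE_all_countable assms(6,10)
    by (intro allI truncated_srrw.AE_average_if_no_truncation[OF T])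
  with truncated_srrw.AE_eventually_untruncated[OF T] show ?thesis
    by eventually_elim blast
qed

end
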